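(* Let $\alpha>1/2$, $d\in\mathbb{N}$, $\tau>0$, let $R>1$ be an odd integer, let $(\gamma_j)_{j\ge1}$ be a non-increasing sequence with $\gamma_j\in(0,1]$, and let $N$ be an odd prime with $N_2>1$. Assume that $$\varepsilon_1:=\frac{|\mathcal{A}_{d,\alpha,\boldsymbol{\gamma}}(N_2)|}{2}\left(\frac{4}{1+\tau\log N_2}\right)^{\lceil R/2\rceil}\le1 .$$ Then, for any $q\in(1/(2\alpha),1)$, with probability at least $1-\varepsilon_1$ over the random generating vectors $\boldsymbol{z}_1,\dots,\boldsymbol{z}_R$, $$\mathrm{err}\bigl(\mathcal{H}_{d,\alpha,\boldsymbol{\gamma}},L_\infty,A_{N,\boldsymbol{z}_{\{1:R\}},\mathcal{A}_{d,\alpha,\boldsymbol{\gamma}}(N_2)}\bigr)\le(2R+1)\left(\frac{1}{(\gamma_1^{1/(4\alpha)}N_2)^{(1/q-1)}}\,\frac{q}{1-q}\prod_{j=1}^d\bigl(1+2\gamma_j^{q}\zeta(2\alpha q)\bigr)^{1/q}\right)^{1/2},$$ where $\zeta$ is the Riemann zeta function.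
   Context: Weights and frequency function: for $\boldsymbol{h}=(h_1,\dots,h_d)\in\mathbb{Z}^d$ let $\mathrm{supp}(\boldsymbol{h})=\{j\in\{1,\dots,d\}: h_j\ne0\}$. With product weights $\gamma_{\mathfrak u}=\prod_{j\in\mathfrak u}\gamma_j$, $\gamma_\emptyset=1$, set $r_{2\alpha,\boldsymbol{\gamma}}(\boldsymbol{h})=\gamma_{\mathrm{supp}(\boldsymbol{h})}^{-1}\prod_{j\in\mathrm{supp}(\boldsymbol{h})}|h_j|^{2\alpha}$, so $r_{2\alpha,\boldsymbol{\gamma}}(\boldsymbol{0})=1$. For real $L\ge0$ let $\mathcal{A}_{d,\alpha,\boldsymbol{\gamma}}(L)=\{\boldsymbol{h}\in\mathbb{Z}^d: r_{2\alpha,\boldsymbol{\gamma}}(\boldsymbol{h})<L^{2\alpha}\}$. Korobov space: for $f\in L_2([0,1]^d)$ let $\widehat f(\boldsymbol{h})=\int_{[0,1]^d}f(\boldsymbol{x})e^{-2\pi \mathtt{i}\,\boldsymbol{h}\cdot\boldsymbol{x}}\,\mathrm{d}\boldsymbol{x}$. The weighted periodic Korobov space $\mathcal{H}_{d,\alpha,\boldsymbol{\gamma}}$ consists of all $f:[0,1]^d\to\mathbb{R}$ in $L_2([0,1]^d)$ with $\|f\|_{d,\alpha,\boldsymbol{\gamma}}^2:=\sum_{\boldsymbol{h}\in\mathbb{Z}^d}|\widehat f(\boldsymbol{h})|^2r_{2\alpha,\boldsymbol{\gamma}}(\boldsymbol{h})<\infty$ (for $\alpha>1/2$ its elements are identified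 with continuous one-periodic functions, given by their absolutely convergent Fourier series). For a map $A:\mathcal{H}_{d,\alpha,\boldsymbol{\gamma}}\to L_p([0,1]^d)$, the worst-case error is $\mathrm{err}(\mathcal{H}_{d,\alpha,\boldsymbol{\gamma}},L_p,A)=\sup\{\|f-A(f)\|_{L_p}: f\in\mathcal{H}_{d,\alpha,\boldsymbol{\gamma}},\ \|f\|_{d,\alpha,\boldsymbol{\gamma}}\le1\}$. Threshold: $P_{N,d}(\tau,\alpha,\boldsymbol{\gamma})=\prod_{j=1}^d\bigl(1+2\gamma_j^{1/(2\alpha)}(1+\tau\log N)\bigr)$ and $N_2=\dfrac{N-1}{\exp(\tau^{-1})\,P_{N,d}(\tau,\alpha,\boldsymbol{\gamma})}$. Median: for odd $R$ and complex $Z_1,\dots,Z_R$, $\mathrm{median}_{r}(Z_r)=\mathrm{median}_r\Re(Z_r)+\mathtt{i}\cdot\mathrm{median}_r\Im(Z_r)$. Median lattice algorithm: draw $\boldsymbol{z}_1,\dots,\boldsymbol{z}_R$ independently and uniformly from $\{1,\dots,N-1\}^d$. For $\boldsymbol{h}\in\mathcal{A}_{d,\alpha,\boldsymbol{\gamma}}(N_2)$ put $\widehat f_{N,\boldsymbol{z}_r}(\boldsymbol{h})=\frac1N\sum_{k=0}^{N-1}f(\{k\boldsymbol{z}_r/N\})\exp(-2\pi\mathtt{i}\,\boldsymbol{h}\cdot(k\boldsymbol{z}_r/N))$, where $\{\cdot\}$ is the componentwise fractional part, and $\widehat f_{N,\boldsymbol{z}_{\{1:R\}}}(\boldsymbol{h})=\mathrm{median}_{r\in\{1,\dots,R\}}\bigl(\widehat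 f_{N,\boldsymbol{z}_r}(\boldsymbol{h})\bigr)$. The output is $(A_{N,\boldsymbol{z}_{\{1:R\}},\mathcal{A}_{d,\alpha,\boldsymbol{\gamma}}(N_2)}(f))(\boldsymbol{x})=\sum_{\boldsymbol{h}\in\mathcal{A}_{d,\alpha,\boldsymbol{\gamma}}(N_2)}\widehat f_{N,\boldsymbol{z}_{\{1:R\}}}(\boldsymbol{h})\exp(2\pi\mathtt{i}\,\boldsymbol{h}\cdot\boldsymbol{x})$. *)

theory Defs
  imports "HOL-Probability.Probability" "HOL-Computational_Algebra.Primes"
begin

text \<open>
  Vectors of length \<open>d\<close> are extensional functions on the index set \<open>{1..d}\<close>; thus
  \<open>{1..d} \<rightarrow>\<^sub>E UNIV\<close> over \<open>int\<close> stands for the integer lattice of dimension \<open>d\<close>.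
\<close>

definition int_vecs :: "nat \<Rightarrow> (nat \<Rightarrow> int) set" where
  "int_vecs d = {1..d} \<rightarrow>\<^sub>E UNIV"

definition dotp :: "nat \<Rightarrow> (nat \<Rightarrow> int) \<Rightarrow> (nat \<Rightarrow> real) \<Rightarrow> real" where
  "dotp d h x = (\<Sum>j=1..d. real_of_int (h j) * x j)"

definition supp :: "nat \<Rightarrow> (nat \<Rightarrow> int) \<Rightarrow> nat set" where
  "supp d h = {j \<in> {1..d}. h j \<noteq> 0}"

definition weight :: "(nat \<Rightarrow> real) \<Rightarrow> nat set \<Rightarrow> real" where
  "weight \<gamma> u = (\<Prod>j\<in>u. \<gamma> j)"

text \<open>The parameter \<open>\<alpha>\<close> is half of the exponent: \<open>freq_weight d \<alpha> \<gamma>\<close> is \<open>r\<close> with index \<open>2\<alpha>\<close>.\<close>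

definition freq_weight :: "nat \<Rightarrow> real \<Rightarrow> (nat \<Rightarrow> real) \<Rightarrow> (nat \<Rightarrow> int) \<Rightarrow> real" where
  "freq_weight d \<alpha> \<gamma> h =
     inverse (weight \<gamma> (supp d h)) * (\<Prod>j\<in>supp d h. \<bar>real_of_int (h j)\<bar> powr (2 * \<alpha>))"

definition freq_set :: "nat \<Rightarrow> real \<Rightarrow> (nat \<Rightarrow> real) \<Rightarrow> real \<Rightarrow> (nat \<Rightarrow> int) set" where
  "freq_set d \<alpha> \<gamma> L = {h \<in> int_vecs d. freq_weight d \<alpha> \<gamma> h < L powr (2 * \<alpha>)}"

text \<open>Lebesgue measure on the unit cube; its space is \<open>{1..d} \<rightarrow>\<^sub>E {0..1}\<close>.\<close>

definition unit_cube :: "nat \<Rightarrow> (nat \<Rightarrow> real) measure" where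
  "unit_cube d = (\<Pi>\<^sub>M j\<in>{1..d}. restrict_space lborel {0..1})"

definition fourier_coeff :: "nat \<Rightarrow> ((nat \<Rightarrow> real) \<Rightarrow> real) \<Rightarrow> (nat \<Rightarrow> int) \<Rightarrow> complex" where
  "fourier_coeff d f h = (LINT x|unit_cube d. of_real (f x) * cis (- (2 * pi * dotp d h x)))"

definition korobov_norm :: "nat \<Rightarrow> real \<Rightarrow> (nat \<Rightarrow> real) \<Rightarrow> ((nat \<Rightarrow> real) \<Rightarrow> real) \<Rightarrow> real" where
  "korobov_norm d \<alpha> \<gamma> f =
     sqrt (\<Sum>\<^sub>\<infinity>h\<in>int_vecs d. (cmod (fourier_coeff d f h))\<^sup>2 * freq_weight d \<alpha> \<gamma> h)"

text \<open>
  For \<open>\<alpha> > 1/2\<close> every class in the Korobov space has exactly one representative that is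
  continuous and one-periodic, and the space consists of these representatives. Only values on
  the closed cube matter; \<open>f\<close> extends to a continuous one-periodic function exactly if it is
  continuous on the cube and takes equal values at points that differ by an integer vector
  (these are points on opposite faces).
\<close>

definition continuous_periodic :: "nat \<Rightarrow> ((nat \<Rightarrow> real) \<Rightarrow> real) \<Rightarrow> bool" where
  "continuous_periodic d f \<longleftrightarrow>
     continuous_on (space (unit_cube d)) f \<and>
     (\<forall>x\<in>space (unit_cube d). \<forall>y\<in>space (unit_cube d).
        (\<forall>j\<in>{1..d}. x j - y j \<in> \<int>) \<longrightarrow> f x = f y)"

definition korobov_space :: "nat \<Rightarrow> real \<Rightarrow> (nat \<Rightarrow> real) \<Rightarrow> ((nat \<Rightarrow> real) \<Rightarrow> real) set" where
  "korobov_space d \<alpha> \<gamma> =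
     {f. f \<in> borel_measurable (unit_cube d) \<and> integrable (unit_cube d) (\<lambda>x. (f x)\<^sup>2) \<and>
         (\<lambda>h. (cmod (fourier_coeff d f h))\<^sup>2 * freq_weight d \<alpha> \<gamma> h) summable_on int_vecs d \<and>
         continuous_periodic d f}"

definition Linf_norm :: "nat \<Rightarrow> ((nat \<Rightarrow> real) \<Rightarrow> complex) \<Rightarrow> ereal" where
  "Linf_norm d g = esssup (unit_cube d) (\<lambda>x. ereal (cmod (g x)))"

definition err_Linf ::
  "nat \<Rightarrow> real \<Rightarrow> (nat \<Rightarrow> real) \<Rightarrow> (((nat \<Rightarrow> real) \<Rightarrow> real) \<Rightarrow> (nat \<Rightarrow> real) \<Rightarrow> complex) \<Rightarrow> ereal" where
  "err_Linf d \<alpha> \<gamma> A =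
     (SUP f\<in>{f \<in> korobov_space d \<alpha> \<gamma>. korobov_norm d \<alpha> \<gamma> f \<le> 1}.
        Linf_norm d (\<lambda>x. of_real (f x) - A f x))"

definition threshold_P :: "nat \<Rightarrow> nat \<Rightarrow> real \<Rightarrow> real \<Rightarrow> (nat \<Rightarrow> real) \<Rightarrow> real" where
  "threshold_P N d \<tau> \<alpha> \<gamma> =
     (\<Prod>j=1..d. 1 + 2 * \<gamma> j powr (1 / (2 * \<alpha>)) * (1 + \<tau> * ln (real N)))"

definition threshold_N2 :: "nat \<Rightarrow> nat \<Rightarrow> real \<Rightarrow> real \<Rightarrow> (nat \<Rightarrow> real) \<Rightarrow> real" where
  "threshold_N2 N d \<tau> \<alpha> \<gamma> = (real N - 1) / (exp (1 / \<tau>) * threshold_P N d \<tau> \<alpha> \<gamma>)"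

text \<open>The middle order statistic of \<open>Z 1, \<dots>, Z R\<close>; intended for odd \<open>R\<close>.\<close>

definition median :: "nat \<Rightarrow> (nat \<Rightarrow> real) \<Rightarrow> real" where
  "median R Z = sort (map Z [1..<Suc R]) ! (R div 2)"

definition cmedian :: "nat \<Rightarrow> (nat \<Rightarrow> complex) \<Rightarrow> complex" where
  "cmedian R Z = Complex (median R (\<lambda>r. Re (Z r))) (median R (\<lambda>r. Im (Z r)))"

definition lattice_coeff ::
  "nat \<Rightarrow> nat \<Rightarrow> (nat \<Rightarrow> nat) \<Rightarrow> ((nat \<Rightarrow> real) \<Rightarrow> real) \<Rightarrow> (nat \<Rightarrow> int) \<Rightarrow> complex" where
  "lattice_coeff d N z f h =
     (\<Sum>k<N. of_real (f (\<lambda>j\<in>{1..d}. frac (real k * real (z j) / real N))) *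
            cis (- (2 * pi * dotp d h (\<lambda>j. real k * real (z j) / real N)))) / of_nat N"

definition median_coeff ::
  "nat \<Rightarrow> nat \<Rightarrow> nat \<Rightarrow> (nat \<Rightarrow> nat \<Rightarrow> nat) \<Rightarrow> ((nat \<Rightarrow> real) \<Rightarrow> real) \<Rightarrow> (nat \<Rightarrow> int) \<Rightarrow> complex" where
  "median_coeff d N R z f h = cmedian R (\<lambda>r. lattice_coeff d N (z r) f h)"

definition median_lattice_alg ::
  "nat \<Rightarrow> nat \<Rightarrow> nat \<Rightarrow> (nat \<Rightarrow> nat \<Rightarrow> nat) \<Rightarrow> (nat \<Rightarrow> int) set \<Rightarrow>
     ((nat \<Rightarrow> real) \<Rightarrow> real) \<Rightarrow> (nat \<Rightarrow> real) \<Rightarrow> complex" where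
  "median_lattice_alg d N R z H f x =
     (\<Sum>h\<in>H. median_coeff d N R z f h * cis (2 * pi * dotp d h x))"

text \<open>Independent uniform draws of generating vectors \<open>z 1, \<dots>, z R\<close> from \<open>{1..N-1}\<^sup>d\<close>.\<close>

definition gen_vectors :: "nat \<Rightarrow> nat \<Rightarrow> nat \<Rightarrow> (nat \<Rightarrow> nat \<Rightarrow> nat) pmf" where
  "gen_vectors d N R = Pi_pmf {1..R} undefined (\<lambda>_. pmf_of_set ({1..d} \<rightarrow>\<^sub>E {1..<N}))"

definition failure_prob :: "nat \<Rightarrow> real \<Rightarrow> (nat \<Rightarrow> real) \<Rightarrow> real \<Rightarrow> nat \<Rightarrow> nat \<Rightarrow> real" where
  "failure_prob d \<alpha> \<gamma> \<tau> N R =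
     real (card (freq_set d \<alpha> \<gamma> (threshold_N2 N d \<tau> \<alpha> \<gamma>))) / 2 *
     (4 / (1 + \<tau> * ln (threshold_N2 N d \<tau> \<alpha> \<gamma>))) ^ nat \<lceil>real R / 2\<rceil>"

text \<open>The Riemann zeta function for real arguments \<open>s > 1\<close>, where the Dirichlet series converges.\<close>

definition zeta :: "real \<Rightarrow> real" where
  "zeta s = (\<Sum>n. 1 / real (Suc n) powr s)"

end

theory Submission imports Defs begin

text \<open>
  Write \<open>A\<close> for the set of computed frequencies. By aliasing, the lattice estimate of the coefficient
  at \<open>h\<close> equals the sum of all Fourier coefficients over the \<open>l\<close> with \<open>(l - h) \<cdot> z \<equiv> 0 (mod N)\<close>. If no
  \<open>l \<in> A\<close> other than \<open>h\<close> occurs here, \<open>z\<close> is good for \<open>h\<close>. For one \<open>z\<close>, the alias classes of the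
  frequencies for which it is good are pairwise disjoint and meet \<open>A\<close> only in these frequencies, so the
  errors at these frequencies add up to at most the truncation error \<open>B\<close>, the sum of all
  coefficients outside \<open>A\<close> in absolute value. If for each \<open>h \<in> A\<close> more than half of the vectors are
  good, the error of the median at \<open>h\<close> is at most twice the sum of the errors of the good vectors
  (once for the real and once for the imaginary part). The total error is then at most
  \<open>(2 R + 1) B\<close>, and \<open>B\<close> is bounded by the Cauchy-Schwarz inequality.

  A single vector fails for \<open>h\<close> with probability at most \<open>(card A - 1) / (N - 1)\<close>, and counting the
  lattice points of \<open>A\<close> one coordinate at a time bounds this by \<open>1 / (1 + \<tau> ln N2)\<close>. A union bound
  over all majorities of failing vectors and over \<open>h \<in> A\<close> gives the failure probability.
\<close>

subsection \<open>Counting frequencies in hyperbolic crosses\<close>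

text \<open>With \<open>g j = \<gamma> j powr (1 / (2 * \<alpha>))\<close>, this is the
  \<open>2 * \<alpha>\<close>-th root of the frequency weight. The root is homogeneous of degree one
  in each nonzero entry, and a general index set \<open>I\<close> allows induction on the
  coordinates.\<close>

definition rho :: "nat set \<Rightarrow> (nat \<Rightarrow> real) \<Rightarrow> (nat \<Rightarrow> int) \<Rightarrow> real" where
  "rho I g h = (\<Prod>i\<in>I. if h i = 0 then 1 else \<bar>real_of_int (h i)\<bar> / g i)"

definition rho_ball :: "nat set \<Rightarrow> (nat \<Rightarrow> real) \<Rightarrow> real \<Rightarrow> (nat \<Rightarrow> int) set" where
  "rho_ball I g L = {h \<in> I \<rightarrow>\<^sub>E UNIV. rho I g h < L}"

section \<open>Partial sums of the zeta function and a bound near its pole\<close>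

lemma powr_telescope:
  fixes x s :: real
  assumes "x > 0" "s > 1"
  shows "(s - 1) * (x + 1) powr (- s) \<le> x powr (1 - s) - (x + 1) powr (1 - s)"
proof -
  \<comment> \<open>The mean value theorem, applied to a primitive of \<open>z powr (- s)\<close> up
    to a constant factor. It replaces the integral test by a telescoping sum.\<close>
  have "\<exists>z>x. z < x + 1 \<and> (x + 1) powr (1 - s) - x powr (1 - s) = (x + 1 - x) * ((1 - s) * z powr (1 - s - 1))"
    by (rule MVT2) (use assms in \<open>auto intro!: derivative_eq_intros\<close>)
  then obtain z where z: "z > x" "z < x + 1"
    "(x + 1) powr (1 - s) - x powr (1 - s) = (1 - s) * z powr (- s)" by auto
  have "(x + 1) powr (- s) \<le> z powr (- s)"
    using assms z by (intro powr_mono2') auto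
  then have "(s - 1) * (x + 1) powr (- s) \<le> (s - 1) * z powr (- s)"
    using assms by (intro mult_left_mono) auto
  with z(3) show ?thesis by (simp add: algebra_simps)
qed

lemma zeta_partial_sum_le:
  assumes "s > 1"
  shows "(\<Sum>n<M. 1 / real (Suc n) powr s) \<le> 1 + 1 / (s - 1)"
proof -
  \<comment> \<open>The first term is set apart, and the negative remainder is kept so that the
    induction step telescopes; it is dropped only at the end.\<close>
  have "(\<Sum>n<Suc M. 1 / real (Suc n) powr s) \<le> 1 + (1 - real (Suc M) powr (1 - s)) / (s - 1)" for M
  proof (induction M)
    case (Suc M)
    have "(s - 1) * (real (Suc M) + 1) powr (- s) \<le> real (Suc M) powr (1 - s) - (real (Suc M) + 1) powr (1 - s)"
      by (rule powr_telescope) (use assms in auto)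
    then have "1 / real (Suc (Suc M)) powr s \<le> (real (Suc M) powr (1 - s) - real (Suc (Suc M)) powr (1 - s)) / (s - 1)"
      using assms by (simp add: field_simps powr_minus)
    with Suc.IH have "(\<Sum>n<Suc (Suc M). 1 / real (Suc n) powr s) \<le>
       1 + (1 - real (Suc M) powr (1 - s)) / (s - 1) + (real (Suc M) powr (1 - s) - real (Suc (Suc M)) powr (1 - s)) / (s - 1)"
      by simp
    also have "\<dots> = 1 + (1 - real (Suc (Suc M)) powr (1 - s)) / (s - 1)"
      by (simp add: diff_divide_distrib)
    finally show ?case .
  qed simp
  note * = this
  show ?thesis
  proof (cases M)
    case (Suc k)
    have "(1 - real (Suc k) powr (1 - s)) / (s - 1) \<le> 1 / (s - 1)"
      using assms by (intro divide_right_mono) auto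
    with *[of k] show ?thesis unfolding Suc by (rule order_trans[OF _ add_left_mono])
  qed (use assms in simp)
qed

lemma summable_zeta:
  assumes "s > 1"
  shows "summable (\<lambda>n. 1 / real (Suc n) powr s)"
proof (rule bounded_imp_summable)
  fix n
  show "(\<Sum>k\<le>n. 1 / real (Suc k) powr s) \<le> 1 + 1 / (s - 1)"
    using zeta_partial_sum_le[OF assms, of "Suc n"] by (simp add: lessThan_Suc_atMost)
qed simp

lemma zeta_le: "s > 1 \<Longrightarrow> zeta s \<le> 1 + 1 / (s - 1)"
  unfolding zeta_def by (rule suminf_le_const[OF summable_zeta]) (use zeta_partial_sum_le in auto)

lemma zeta_partial_sum_le_zeta: "s > 1 \<Longrightarrow> (\<Sum>n<M. 1 / real (Suc n) powr s) \<le> zeta s"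
  unfolding zeta_def by (intro sum_le_suminf summable_zeta) auto

lemma zeta_nonneg: "s > 1 \<Longrightarrow> zeta s \<ge> 0"
  using zeta_partial_sum_le_zeta[of s 0] by simp

lemma sum_int_interval_symmetric:
  fixes F :: "int \<Rightarrow> real"
  assumes "\<And>k. F (- k) = F k"
  shows "(\<Sum>k\<in>{- int M..int M}. F k) = F 0 + 2 * (\<Sum>n<M. F (int (Suc n)))"
proof -
  have "(\<Sum>k\<in>{- int M..int M}. F k) = F 0 + (\<Sum>n<M. F (int (Suc n)) + F (- int (Suc n)))"
  proof (induction M)
    case (Suc M)
    have "{- int (Suc M)..int (Suc M)} = insert (int (Suc M)) (insert (- int (Suc M)) {- int M..int M})"
      by auto
    with Suc.IH show ?case by simp
  qed simp
  then show ?thesis by (simp only: assms sum.distrib mult_2)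
qed

section \<open>Sums and cardinalities over the sets \<open>rho_ball\<close>\<close>

lemma rho_pos: "(\<And>i. i \<in> I \<Longrightarrow> g i > 0) \<Longrightarrow> rho I g h > 0"
  unfolding rho_def by (intro prod_pos) auto

text \<open>Because \<open>g i \<le> 1\<close>, every factor of the product is at least 1, so a
  single factor never exceeds the product.\<close>

lemma rho_coordinate_le:
  assumes "finite I" "\<And>i. i \<in> I \<Longrightarrow> 0 < g i \<and> g i \<le> 1" "j \<in> I"
  shows "\<bar>real_of_int (h j)\<bar> \<le> g j * rho I g h"
proof -
  have ge1: "1 \<le> (if h i = 0 then 1 else \<bar>real_of_int (h i)\<bar> / g i)" if "i \<in> I" for i
    using assms(2)[OF that] by (auto simp: field_simps)
  have "rho I g h = (if h j = 0 then 1 else \<bar>real_of_int (h j)\<bar> / g j) *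
        (\<Prod>i\<in>I - {j}. if h i = 0 then 1 else \<bar>real_of_int (h i)\<bar> / g i)"
    unfolding rho_def by (rule prod.remove) (use assms in auto)
  moreover have "1 \<le> (\<Prod>i\<in>I - {j}. if h i = 0 then 1 else \<bar>real_of_int (h i)\<bar> / g i)"
    by (rule prod_ge_1) (use ge1 in auto)
  ultimately have "rho I g h \<ge> (if h j = 0 then 1 else \<bar>real_of_int (h j)\<bar> / g j)"
    using ge1[OF assms(3)] by (simp add: mult_le_cancel_left1)
  then show ?thesis using assms(2)[OF assms(3)] by (auto simp: field_simps split: if_splits)
qed

lemma rho_ge_1:
  assumes "\<And>i. i \<in> I \<Longrightarrow> 0 < g i \<and> g i \<le> 1"
  shows "rho I g h \<ge> 1"
proof -
  have "1 \<le> (if h i = 0 then 1 else \<bar>real_of_int (h i)\<bar> / g i)" if "i \<in> I" for i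
    using assms[OF that] by (auto simp: field_simps)
  then show ?thesis unfolding rho_def by (rule prod_ge_1)
qed

text \<open>Over a box, a sum of products factors into one-dimensional sums; this lemma allows any
  finite sum of nonnegative terms to be enlarged to such a sum.\<close>

lemma finite_subset_PiE_interval:
  fixes F :: "(nat \<Rightarrow> int) set"
  assumes "finite I" "finite F" "F \<subseteq> I \<rightarrow>\<^sub>E UNIV"
  obtains M where "F \<subseteq> I \<rightarrow>\<^sub>E {- int M..int M}"
proof
  define M where "M = nat (\<Sum>h\<in>F. \<Sum>i\<in>I. \<bar>h i\<bar>)"
  have "\<bar>h i\<bar> \<le> int M" if "h \<in> F" "i \<in> I" for h i
  proof -
    have "\<bar>h i\<bar> \<le> (\<Sum>i\<in>I. \<bar>h i\<bar>)"
      by (rule member_le_sum) (use that assms in auto)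
    also have "\<dots> \<le> (\<Sum>h\<in>F. \<Sum>i\<in>I. \<bar>h i\<bar>)"
      by (rule member_le_sum) (use that assms in \<open>auto intro: sum_nonneg\<close>)
    finally show ?thesis unfolding M_def by linarith
  qed
  then have "h i \<in> {- int M..int M}" if "h \<in> F" "i \<in> I" for h i
    using that by (force simp: abs_le_iff)
  then show "F \<subseteq> I \<rightarrow>\<^sub>E {- int M..int M}"
    using assms(3) unfolding PiE_iff subset_iff by blast
qed

text \<open>Enlarging \<open>F\<close> to a symmetric box turns the left side into a product of
  one-dimensional sums. In each of them the entry 0 contributes 1, and the two signs contribute
  equal partial sums of the zeta series.\<close>

lemma sum_rho_powr_le:
  assumes "finite I" and g: "\<And>i. i \<in> I \<Longrightarrow> 0 < g i" and s: "s > 1"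
    and F: "finite F" "F \<subseteq> I \<rightarrow>\<^sub>E UNIV"
  shows "(\<Sum>h\<in>F. rho I g h powr (- s)) \<le> (\<Prod>i\<in>I. 1 + 2 * g i powr s * zeta s)"
proof -
  define w where "w i k = (if k = 0 then 1 else \<bar>real_of_int k\<bar> / g i) powr (- s)" for i and k :: int
  obtain M where M: "F \<subseteq> I \<rightarrow>\<^sub>E {- int M..int M}"
    using finite_subset_PiE_interval[OF assms(1) F] .
  have rho_w: "rho I g h powr (- s) = (\<Prod>i\<in>I. w i (h i))" for h
    unfolding rho_def w_def by (rule prod_powr_distrib)
  have "(\<Sum>h\<in>F. rho I g h powr (- s)) \<le> (\<Sum>h\<in>I \<rightarrow>\<^sub>E {- int M..int M}. rho I g h powr (- s))"
    using M assms(1) by (intro sum_mono2) (auto intro!: finite_PiE)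
  also have "\<dots> = (\<Prod>i\<in>I. \<Sum>k\<in>{- int M..int M}. w i k)"
    unfolding rho_w by (subst prod_sum_PiE) (use assms(1) in auto)
  also have "\<dots> \<le> (\<Prod>i\<in>I. 1 + 2 * g i powr s * zeta s)"
  proof (intro prod_mono conjI)
    fix i assume i: "i \<in> I"
    show "0 \<le> (\<Sum>k\<in>{- int M..int M}. w i k)" by (auto simp: w_def intro!: sum_nonneg)
    have "(\<Sum>k\<in>{- int M..int M}. w i k) = w i 0 + 2 * (\<Sum>n<M. w i (int (Suc n)))"
      by (rule sum_int_interval_symmetric) (auto simp: w_def)
    also have "\<dots> = 1 + 2 * (\<Sum>n<M. g i powr s * (1 / real (Suc n) powr s))"
    proof -
      have "w i (int (Suc n)) = g i powr s * (1 / real (Suc n) powr s)" for n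
      proof -
        have "w i (int (Suc n)) = (real (Suc n) / g i) powr (- s)" unfolding w_def by auto
        also have "\<dots> = g i powr s * (1 / real (Suc n) powr s)"
          using g[OF i] by (simp add: powr_divide powr_minus field_simps del: of_nat_Suc)
        finally show ?thesis .
      qed
      then show ?thesis by (simp add: w_def)
    qed
    also have "\<dots> = 1 + 2 * g i powr s * (\<Sum>n<M. 1 / real (Suc n) powr s)"
      by (simp add: sum_distrib_left mult.assoc)
    also have "\<dots> \<le> 1 + 2 * g i powr s * zeta s"
      by (intro add_left_mono mult_left_mono zeta_partial_sum_le_zeta s) auto
    finally show "(\<Sum>k\<in>{- int M..int M}. w i k) \<le> 1 + 2 * g i powr s * zeta s" .
  qed
  finally show ?thesis .
qed

lemma finite_rho_ball:
  assumes "finite I" "\<And>i. i \<in> I \<Longrightarrow> 0 < g i \<and> g i \<le> 1"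
  shows "finite (rho_ball I g L)"
proof (rule finite_subset)
  show "rho_ball I g L \<subseteq> I \<rightarrow>\<^sub>E {- \<lceil>\<bar>L\<bar>\<rceil>..\<lceil>\<bar>L\<bar>\<rceil>}"
  proof (intro subsetI, unfold PiE_iff, intro conjI ballI)
    fix h j assume h: "h \<in> rho_ball I g L" and j: "j \<in> I"
    have "\<bar>real_of_int (h j)\<bar> \<le> g j * rho I g h" by (rule rho_coordinate_le[OF assms j])
    also have "\<dots> \<le> 1 * rho I g h"
      using assms(2)[OF j] rho_ge_1[of I g h] assms(2) by (intro mult_right_mono) auto
    also have "\<dots> \<le> \<bar>L\<bar>" using h by (auto simp: rho_ball_def)
    finally have "real_of_int \<bar>h j\<bar> \<le> real_of_int \<lceil>\<bar>L\<bar>\<rceil>" by linarith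
    then have "\<bar>h j\<bar> \<le> \<lceil>\<bar>L\<bar>\<rceil>" by (simp only: of_int_le_iff)
    then show "h j \<in> {- \<lceil>\<bar>L\<bar>\<rceil>..\<lceil>\<bar>L\<bar>\<rceil>}" by auto
  qed (auto simp: rho_ball_def PiE_iff)
  show "finite (I \<rightarrow>\<^sub>E {- \<lceil>\<bar>L\<bar>\<rceil>..\<lceil>\<bar>L\<bar>\<rceil>})" using assms(1) by (intro finite_PiE) auto
qed

text \<open>Excluding 0 removes the additive constant from the count. In the recursion over
  coordinates the entry 0 then accounts for exactly one copy of the lower-dimensional set.\<close>

lemma card_nonzero_ints_le:
  assumes "x \<ge> 0"
  shows "real (card {k::int. k \<noteq> 0 \<and> \<bar>real_of_int k\<bar> \<le> x}) \<le> 2 * x"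
proof -
  have "{k::int. k \<noteq> 0 \<and> \<bar>real_of_int k\<bar> \<le> x} \<subseteq> {- \<lfloor>x\<rfloor>..\<lfloor>x\<rfloor>} - {0}"
    by (auto simp: abs_le_iff le_floor_iff minus_le_iff)
  then have "card {k::int. k \<noteq> 0 \<and> \<bar>real_of_int k\<bar> \<le> x} \<le> card ({- \<lfloor>x\<rfloor>..\<lfloor>x\<rfloor>} - {0})"
    by (intro card_mono) auto
  also have "\<dots> = nat (2 * \<lfloor>x\<rfloor>)" using assms by (subst card_Diff_singleton) auto
  finally show ?thesis using assms by linarith
qed

text \<open>The larger set is sliced over the coordinates in \<open>I\<close>. The slice over
  \<open>h\<close> consists of the entry 0 and of nonzero entries of absolute value at most
  \<open>g j * L / rho I g h\<close>.\<close>

lemma card_rho_ball_insert_le: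
  assumes I: "finite I" "j \<notin> I" and g: "\<And>i. i \<in> insert j I \<Longrightarrow> 0 < g i \<and> g i \<le> 1" and L: "L > 0"
  shows "real (card (rho_ball (insert j I) g L)) \<le>
         real (card (rho_ball I g L)) + 2 * g j * L * (\<Sum>h\<in>rho_ball I g L. rho I g h powr (- 1))"
proof -
  define S where "S h = insert 0 {k::int. k \<noteq> 0 \<and> \<bar>real_of_int k\<bar> \<le> g j * L / rho I g h}" for h
  have fin: "finite (rho_ball I g L)" by (rule finite_rho_ball) (use I g in auto)
  have pos: "rho I g h > 0" for h by (rule rho_pos) (use g in auto)
  have fS: "finite (S h)" for h
  proof -
    have "{k::int. \<bar>real_of_int k\<bar> \<le> x} \<subseteq> {- \<lceil>x\<rceil>..\<lceil>x\<rceil>}" for x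
      by (auto simp: abs_le_iff) linarith+
    then show ?thesis unfolding S_def by (auto intro: finite_subset[rotated])
  qed
  have "rho_ball (insert j I) g L \<subseteq> (\<lambda>(h, k). h(j := k)) ` (SIGMA h:rho_ball I g L. S h)"
  proof
    fix h assume h: "h \<in> rho_ball (insert j I) g L"
    \<comment> \<open>Since \<open>j\<close> is not in \<open>I\<close>, extensionality on
      \<open>I\<close> forces the value \<open>undefined\<close> at \<open>j\<close>.\<close>
    define h' where "h' = h(j := undefined)"
    have "rho (insert j I) g h = (if h j = 0 then 1 else \<bar>real_of_int (h j)\<bar> / g j) * rho I g h'"
      unfolding rho_def using I by (subst prod.insert) (auto simp: h'_def intro!: arg_cong2[where f = "(*)"] prod.cong)
    with h have lt: "(if h j = 0 then 1 else \<bar>real_of_int (h j)\<bar> / g j) * rho I g h' < L"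
      by (auto simp: rho_ball_def)
    have "1 * rho I g h' \<le> (if h j = 0 then 1 else \<bar>real_of_int (h j)\<bar> / g j) * rho I g h'"
      using g[of j] by (intro mult_right_mono less_imp_le[OF pos]) (auto simp: field_simps)
    with lt have "rho I g h' < L" by simp
    moreover have "h' \<in> I \<rightarrow>\<^sub>E UNIV" using h I by (auto simp: rho_ball_def h'_def PiE_iff extensional_def)
    ultimately have "h' \<in> rho_ball I g L" by (auto simp: rho_ball_def)
    moreover have "h j \<in> S h'"
      using lt pos[of h'] g[of j] by (auto simp: S_def field_simps split: if_splits)
    moreover have "h = h'(j := h j)" by (auto simp: h'_def)
    ultimately show "h \<in> (\<lambda>(h, k). h(j := k)) ` (SIGMA h:rho_ball I g L. S h)"
      by (intro image_eqI[where x = "(h', h j)"]) auto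
  qed
  then have "card (rho_ball (insert j I) g L) \<le> card (SIGMA h:rho_ball I g L. S h)"
    using fin fS by (meson card_image_le card_mono finite_SigmaI finite_imageI order_trans)
  also have "\<dots> = (\<Sum>h\<in>rho_ball I g L. card (S h))" using fin fS by (simp add: card_SigmaI)
  finally have "real (card (rho_ball (insert j I) g L)) \<le> (\<Sum>h\<in>rho_ball I g L. real (card (S h)))"
    by (metis of_nat_mono of_nat_sum)
  also have "\<dots> \<le> (\<Sum>h\<in>rho_ball I g L. 1 + 2 * g j * L * rho I g h powr (- 1))"
  proof (rule sum_mono)
    fix h
    have "real (card (S h)) \<le> 1 + 2 * (g j * L / rho I g h)"
      using card_nonzero_ints_le[of "g j * L / rho I g h"] pos[of h] g[of j] L fS[of h]
      unfolding S_def by (subst card_insert_disjoint) auto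
    also have "\<dots> = 1 + 2 * g j * L * rho I g h powr (- 1)"
      using pos[of h] by (simp add: powr_minus field_simps)
    finally show "real (card (S h)) \<le> 1 + 2 * g j * L * rho I g h powr (- 1)" .
  qed
  finally show ?thesis by (simp add: sum.distrib sum_distrib_left)
qed

text \<open>
  The exponent \<open>1\<close> is raised to \<open>1 + 1 / (\<tau> ln L)\<close>, at the price of the factor
  \<open>L powr (1 / (\<tau> ln L)) = exp (1 / \<tau>)\<close>.
\<close>

lemma sum_rho_ball_le:
  assumes "finite I" and g: "\<And>i. i \<in> I \<Longrightarrow> 0 < g i \<and> g i \<le> 1" and L: "L > 1" and \<tau>: "\<tau> > 0"
  shows "(\<Sum>h\<in>rho_ball I g L. rho I g h powr (- 1)) \<le> exp (1 / \<tau>) * (\<Prod>i\<in>I. 1 + 2 * g i * (1 + \<tau> * ln L))"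
proof -
  define e where "e = 1 / (\<tau> * ln L)"
  have e: "e > 0" using L \<tau> by (simp add: e_def)
  have Le: "L powr e = exp (1 / \<tau>)" using L \<tau> by (simp add: powr_def e_def)
  have fin: "finite (rho_ball I g L)" by (rule finite_rho_ball) (use assms in auto)
  have "(\<Sum>h\<in>rho_ball I g L. rho I g h powr (- 1)) \<le> (\<Sum>h\<in>rho_ball I g L. exp (1 / \<tau>) * rho I g h powr (- (1 + e)))"
  proof (rule sum_mono)
    fix h assume h: "h \<in> rho_ball I g L"
    have pos: "rho I g h > 0" by (rule rho_pos) (use g in auto)
    have "rho I g h powr e \<le> L powr e" using h pos e by (intro powr_mono2) (auto simp: rho_ball_def)
    then have "rho I g h powr e * rho I g h powr (- (1 + e)) \<le> exp (1 / \<tau>) * rho I g h powr (- (1 + e))"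
      unfolding Le by (rule mult_right_mono) auto
    then show "rho I g h powr (- 1) \<le> exp (1 / \<tau>) * rho I g h powr (- (1 + e))"
      by (simp flip: powr_add)
  qed
  also have "\<dots> = exp (1 / \<tau>) * (\<Sum>h\<in>rho_ball I g L. rho I g h powr (- (1 + e)))"
    by (simp add: sum_distrib_left)
  also have "\<dots> \<le> exp (1 / \<tau>) * (\<Prod>i\<in>I. 1 + 2 * g i powr (1 + e) * zeta (1 + e))"
    using assms e fin by (intro mult_left_mono sum_rho_powr_le) (auto simp: rho_ball_def)
  also have "\<dots> \<le> exp (1 / \<tau>) * (\<Prod>i\<in>I. 1 + 2 * g i * (1 + \<tau> * ln L))"
  proof (intro mult_left_mono prod_mono conjI add_left_mono mult_mono)
    fix i assume i: "i \<in> I"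
    show "0 \<le> 1 + 2 * g i powr (1 + e) * zeta (1 + e)" using e by (auto intro!: add_nonneg_nonneg mult_nonneg_nonneg zeta_nonneg)
    \<comment> \<open>A base of at most 1 shrinks when its exponent grows, and
      \<open>1 / e = \<tau> * ln L\<close> turns the bound for \<open>zeta (1 + e)\<close> into the
      required factor.\<close>
    show "g i powr (1 + e) \<le> g i" using g[OF i] e powr_mono'[of 1 "1 + e" "g i"] by auto
    show "zeta (1 + e) \<le> 1 + \<tau> * ln L" using zeta_le[of "1 + e"] e by (simp add: e_def)
    show "0 \<le> zeta (1 + e)" using e by (auto intro!: zeta_nonneg)
  qed (use g in \<open>auto simp: less_imp_le\<close>)
  finally show ?thesis .
qed

text \<open>Induction on the coordinates. For empty \<open>I\<close> the set has one element and
  both sides are 0. Adding \<open>j\<close> increases the left side by at most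
  \<open>2 * g j * T * L * exp (1 / \<tau>) * P\<close>, where \<open>T\<close> is the logarithmic
  factor and \<open>P\<close> the product so far; this is exactly the increment of the right
  side.\<close>

lemma card_rho_ball_le:
  assumes "finite I" and g: "\<And>i. i \<in> I \<Longrightarrow> 0 < g i \<and> g i \<le> 1" and L: "L > 1" and \<tau>: "\<tau> > 0"
  shows "(1 + \<tau> * ln L) * (real (card (rho_ball I g L)) - 1) \<le>
         L * exp (1 / \<tau>) * ((\<Prod>i\<in>I. 1 + 2 * g i * (1 + \<tau> * ln L)) - 1)"
  using assms(1,2)
proof (induction I rule: finite_induct)
  case empty
  then show ?case using L by (simp add: rho_ball_def rho_def)
next
  case (insert j I)
  define T where "T = 1 + \<tau> * ln L"
  define P where "P = (\<Prod>i\<in>I. 1 + 2 * g i * T)"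
  define S where "S = (\<Sum>h\<in>rho_ball I g L. rho I g h powr (- 1))"
  have T: "T > 0" unfolding T_def using L \<tau> by (intro add_pos_nonneg) auto
  have gj: "0 < g j" using insert.prems by auto
  have S: "S \<le> exp (1 / \<tau>) * P" unfolding S_def P_def T_def
    by (rule sum_rho_ball_le) (use insert L \<tau> in auto)
  have IH: "T * (real (card (rho_ball I g L)) - 1) \<le> L * exp (1 / \<tau>) * (P - 1)"
    unfolding T_def P_def by (rule insert.IH) (use insert.prems in auto)
  have "real (card (rho_ball (insert j I) g L)) \<le> real (card (rho_ball I g L)) + 2 * g j * L * S"
    unfolding S_def by (rule card_rho_ball_insert_le) (use insert L in auto)
  then have "T * (real (card (rho_ball (insert j I) g L)) - 1) \<le>
     T * (real (card (rho_ball I g L)) + 2 * g j * L * S - 1)"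
    using T by (intro mult_left_mono) auto
  also have "\<dots> = T * (real (card (rho_ball I g L)) - 1) + T * 2 * g j * L * S"
    by (simp add: algebra_simps)
  also have "\<dots> \<le> L * exp (1 / \<tau>) * (P - 1) + T * 2 * g j * L * (exp (1 / \<tau>) * P)"
    using T gj L by (intro add_mono IH mult_left_mono S) auto
  also have "\<dots> = L * exp (1 / \<tau>) * ((1 + 2 * g j * T) * P - 1)"
    by (simp add: algebra_simps)
  also have "(1 + 2 * g j * T) * P = (\<Prod>i\<in>insert j I. 1 + 2 * g i * T)"
    unfolding P_def using insert.hyps by simp
  finally show ?case unfolding T_def .
qed

section \<open>From frequency weights to \<open>rho\<close>\<close>

lemma freq_weight_eq_rho:
  assumes "\<alpha> > 0" "\<And>j. 1 \<le> j \<Longrightarrow> 0 < \<gamma> j"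
  shows "freq_weight d \<alpha> \<gamma> h = rho {1..d} (\<lambda>j. \<gamma> j powr (1 / (2 * \<alpha>))) h powr (2 * \<alpha>)"
proof -
  have "rho {1..d} (\<lambda>j. \<gamma> j powr (1 / (2 * \<alpha>))) h powr (2 * \<alpha>) =
     (\<Prod>j=1..d. (if h j = 0 then 1 else \<bar>real_of_int (h j)\<bar> / \<gamma> j powr (1 / (2 * \<alpha>))) powr (2 * \<alpha>))"
    unfolding rho_def by (rule prod_powr_distrib)
  also have "\<dots> = (\<Prod>j=1..d. if h j \<noteq> 0 then inverse (\<gamma> j) * \<bar>real_of_int (h j)\<bar> powr (2 * \<alpha>) else 1)"
  proof (rule prod.cong)
    fix j assume "j \<in> {1..d}"
    then have "\<gamma> j > 0" using assms(2) by simp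
    then show "(if h j = 0 then 1 else \<bar>real_of_int (h j)\<bar> / \<gamma> j powr (1 / (2 * \<alpha>))) powr (2 * \<alpha>) =
        (if h j \<noteq> 0 then inverse (\<gamma> j) * \<bar>real_of_int (h j)\<bar> powr (2 * \<alpha>) else 1)"
      using assms(1) by (simp add: powr_divide powr_powr field_simps)
  qed simp
  also have "\<dots> = (\<Prod>j\<in>supp d h. inverse (\<gamma> j) * \<bar>real_of_int (h j)\<bar> powr (2 * \<alpha>))"
    unfolding supp_def by (rule prod.inter_filter[symmetric]) auto
  also have "\<dots> = freq_weight d \<alpha> \<gamma> h"
    unfolding freq_weight_def weight_def prod.distrib by (simp add: prod_inversef[symmetric] o_def)
  finally show ?thesis ..
qed

lemma freq_set_eq_rho_ball:
  assumes "\<alpha> > 0" "\<And>j. 1 \<le> j \<Longrightarrow> 0 < \<gamma> j" "L \<ge> 0"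
  shows "freq_set d \<alpha> \<gamma> L = rho_ball {1..d} (\<lambda>j. \<gamma> j powr (1 / (2 * \<alpha>))) L"
proof -
  define g where "g j = \<gamma> j powr (1 / (2 * \<alpha>))" for j
  have "g j > 0" if "j \<in> {1..d}" for j using that assms(2)[of j] by (simp add: g_def)
  then have "rho {1..d} g h > 0" for h by (rule rho_pos)
  then have "rho {1..d} g h powr (2 * \<alpha>) < L powr (2 * \<alpha>) \<longleftrightarrow> rho {1..d} g h < L" for h
    using assms(1,3) by (metis less_imp_le linorder_not_le mult_pos_pos powr_less_mono2 powr_mono2 zero_less_numeral)
  then show ?thesis
    unfolding freq_set_def rho_ball_def int_vecs_def g_def
    by (simp add: freq_weight_eq_rho assms)
qed

text \<open>Meant for \<open>s = 1 / q - 1\<close>, where \<open>1 / s = q / (1 - q)\<close> and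
  \<open>1 + s = 1 / q\<close> are the constants of the error bound. From
  \<open>1 + t \<le> exp t\<close> follows \<open>P + s * P * ln P \<le> P powr (1 + s)\<close>, and
  \<open>1 - 1 / P \<le> ln P\<close> finishes the argument.\<close>

lemma Bernoulli_product_bound:
  fixes P s :: real
  assumes "P \<ge> 1" "s > 0"
  shows "s * (P - 1) \<le> P powr (1 + s)"
proof -
  have "1 + s * ln P \<le> P powr s"
    using exp_ge_add_one_self[of "s * ln P"] assms by (simp add: powr_def)
  then have "P * (1 + s * ln P) \<le> P powr (1 + s)"
    using assms by (simp add: powr_add)
  moreover have "1 - 1 / P \<le> ln P"
    using ln_le_minus_one[of "1 / P"] assms by (simp add: ln_div)
  then have "P * s * (1 - 1 / P) \<le> P * s * ln P"
    using assms by (intro mult_left_mono) auto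
  moreover have "P * s * (1 - 1 / P) = s * (P - 1)"
    using assms by (simp add: field_simps)
  ultimately show ?thesis using assms by (simp add: algebra_simps)
qed

subsection \<open>Fourier inversion on the torus\<close>

abbreviation unit_interval :: "real measure" where
  "unit_interval \<equiv> restrict_space lborel {0..1}"

abbreviation cube :: "nat \<Rightarrow> (nat \<Rightarrow> real) set" where
  "cube d \<equiv> space (unit_cube d)"

definition fchar :: "nat \<Rightarrow> (nat \<Rightarrow> int) \<Rightarrow> (nat \<Rightarrow> real) \<Rightarrow> complex" where
  "fchar d h x = cis (2 * pi * dotp d h x)"

lemma prob_space_unit_interval: "prob_space unit_interval"
  by (rule prob_space_restrict_space) auto

interpretation unit_interval: prob_space unit_interval
  by (rule prob_space_unit_interval)

interpretation unit_cube: product_sigma_finite "\<lambda>_::nat. unit_interval"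
  by unfold_locales

lemma prob_space_unit_cube: "prob_space (unit_cube d)"
  unfolding unit_cube_def by (rule prob_space_PiM) (rule prob_space_unit_interval)

lemma cube_eq: "cube d = {1..d} \<rightarrow>\<^sub>E {0..1}"
  by (simp add: unit_cube_def space_PiM space_restrict_space)

text \<open>Extensional functions have the fixed value \<open>undefined\<close> outside
  \<open>{1..d}\<close>. The cube is therefore a product of compact sets over all natural numbers,
  and Tychonoff's theorem applies.\<close>

lemma compact_cube: "compact (cube d)"
proof -
  have "cube d = Pi\<^sub>E UNIV (\<lambda>j. if j \<in> {1..d} then {0..1} else {undefined})"
    unfolding cube_eq
    by (intro set_eqI, simp only: PiE_iff extensional_def mem_Collect_eq Ball_def UNIV_I) (metis UNIV_I singleton_iff)
  then have "compactin (product_topology (\<lambda>_. euclidean) UNIV) (cube d)"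
    by (simp only: compactin_PiE) auto
  then show ?thesis by (simp add: euclidean_product_topology)
qed

lemma measurable_unit_cube_component: "(\<lambda>x. x j) \<in> borel_measurable (unit_cube d)"
proof (cases "j \<in> {1..d}")
  case True
  then have "(\<lambda>x. x j) \<in> measurable (unit_cube d) unit_interval"
    unfolding unit_cube_def by (rule measurable_component_singleton)
  then have "(\<lambda>x. x j) \<in> measurable (unit_cube d) lborel"
    by (rule measurable_restrict_space2_iff[THEN iffD1, THEN conjunct1])
  then show ?thesis by simp
next
  case False
  have "(\<lambda>x. x j) \<in> borel_measurable (unit_cube d) \<longleftrightarrow> (\<lambda>x. undefined :: real) \<in> borel_measurable (unit_cube d)"
    by (rule measurable_cong) (use False in \<open>auto simp: cube_eq PiE_iff extensional_def\<close>)
  then show ?thesis by simp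
qed

text \<open>The sigma-algebra of \<open>unit_cube d\<close> is a product sigma-algebra, while
  continuity refers to the topology of the whole function space. The identity map connects the two:
  it is Borel measurable because each coordinate is.\<close>

lemma borel_measurable_continuous_on_cube:
  fixes g :: "(nat \<Rightarrow> real) \<Rightarrow> 'b::topological_space"
  assumes "continuous_on (cube d) g"
  shows "g \<in> borel_measurable (unit_cube d)"
proof -
  have "(\<lambda>x. x) \<in> borel_measurable (unit_cube d)"
    by (rule measurable_coordinatewise_then_product) (rule measurable_unit_cube_component)
  then have "(\<lambda>x. x) \<in> measurable (unit_cube d) (restrict_space borel (cube d))"
    by (intro measurable_restrict_space2) auto
  from measurable_compose[OF this borel_measurable_continuous_on_restrict[OF assms]]
  show ?thesis .
qed

lemma integrable_continuous_on_cube: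
  fixes g :: "(nat \<Rightarrow> real) \<Rightarrow> 'b::{banach, second_countable_topology}"
  assumes "continuous_on (cube d) g"
  shows "integrable (unit_cube d) g"
proof -
  interpret prob_space "unit_cube d" by (rule prob_space_unit_cube)
  have "bounded (g ` cube d)"
    by (intro compact_imp_bounded compact_continuous_image assms compact_cube)
  then obtain B where "\<And>x. x \<in> cube d \<Longrightarrow> norm (g x) \<le> B" by (auto simp: bounded_iff)
  then show ?thesis
    by (intro integrable_const_bound[where B = B] borel_measurable_continuous_on_cube assms) auto
qed

lemma norm_integral_unit_cube_le:
  fixes g :: "(nat \<Rightarrow> real) \<Rightarrow> 'b::{banach, second_countable_topology}"
  assumes "continuous_on (cube d) g" "\<And>x. x \<in> cube d \<Longrightarrow> norm (g x) \<le> B"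
  shows "norm (LINT x|unit_cube d. g x) \<le> B"
proof -
  interpret prob_space "unit_cube d" by (rule prob_space_unit_cube)
  have "norm (LINT x|unit_cube d. g x) \<le> (LINT x|unit_cube d. norm (g x))" by (rule integral_norm_bound)
  also have "\<dots> \<le> B"
    by (intro integral_le_const AE_I2 integrable_norm integrable_continuous_on_cube assms) auto
  finally show ?thesis .
qed

section \<open>Characters and their orthogonality\<close>

lemma continuous_on_fchar: "continuous_on A (fchar d h)"
proof -
  have "continuous_on A (\<lambda>x. dotp d h x)"
    unfolding dotp_def
    by (intro continuous_intros continuous_on_product_then_coordinatewise[where f = "\<lambda>x. x"])
  then show ?thesis unfolding fchar_def cis_conv_exp by (intro continuous_intros)
qed

lemma norm_fchar [simp]: "cmod (fchar d h x) = 1"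
  by (simp add: fchar_def)

lemma dotp_cong: "(\<And>j. j \<in> {1..d} \<Longrightarrow> h j = h' j) \<Longrightarrow> dotp d h x = dotp d h' x"
  unfolding dotp_def by (intro sum.cong) auto

lemma fchar_periodic:
  assumes "\<And>j. j \<in> {1..d} \<Longrightarrow> x j - y j \<in> \<int>"
  shows "fchar d h x = fchar d h y"
proof -
  have "dotp d h x - dotp d h y = (\<Sum>j=1..d. real_of_int (h j) * (x j - y j))"
    by (simp add: dotp_def sum_subtractf right_diff_distrib)
  also have "\<dots> \<in> \<int>" by (intro Ints_sum Ints_mult assms) auto
  finally obtain n :: int where "dotp d h x = dotp d h y + real_of_int n"
    by (metis Ints_cases add.commute diff_add_cancel)
  then have "fchar d h x = fchar d h y * cis (2 * pi * real_of_int n)"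
    unfolding fchar_def cis_mult by (simp only: distrib_left)
  moreover have "cis (2 * pi * real_of_int n) = 1" by (rule cis_multiple_2pi) simp
  ultimately show ?thesis by simp
qed

lemma fchar_mult: "fchar d h x * fchar d l x = fchar d (\<lambda>j\<in>{1..d}. h j + l j) x"
proof -
  have "dotp d (\<lambda>j\<in>{1..d}. h j + l j) x = dotp d h x + dotp d l x"
    unfolding dotp_def sum.distrib[symmetric] by (intro sum.cong) (auto simp: distrib_right)
  then show ?thesis by (simp add: fchar_def cis_mult distrib_left)
qed

lemma fchar_uminus: "fchar d (\<lambda>j\<in>{1..d}. - h j) x = cis (- (2 * pi * dotp d h x))"
proof -
  have "dotp d (\<lambda>j\<in>{1..d}. - h j) x = - dotp d h x"
    unfolding dotp_def sum_negf[symmetric] by (intro sum.cong) auto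
  then show ?thesis by (simp add: fchar_def)
qed

lemma integral_cis_unit_interval:
  "(LINT t|unit_interval. cis (2 * pi * (real_of_int k * t))) = (if k = 0 then 1 else 0)"
proof (cases "k = 0")
  case True
  then show ?thesis by (simp add: measure_restrict_space)
next
  case False
  define c where "c = \<i> * complex_of_real (2 * pi * real_of_int k)"
  have c: "c \<noteq> 0" using False by (simp add: c_def)
  have cis_eq: "cis (2 * pi * (real_of_int k * t)) = exp (c * complex_of_real t)" for t
    by (simp add: cis_conv_exp c_def algebra_simps)
  have "(LINT t|unit_interval. cis (2 * pi * (real_of_int k * t))) =
        (LINT t|lborel. indicator {0..1} t *\<^sub>R exp (c * complex_of_real t))"
    unfolding cis_eq by (rule integral_restrict_space) simp
  also have "\<dots> = exp (c * complex_of_real 1) / c - exp (c * complex_of_real 0) / c"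
  proof (rule integral_FTC_atLeastAtMost)
    show "((\<lambda>t. exp (c * complex_of_real t) / c) has_vector_derivative exp (c * complex_of_real t)) (at t within {0..1})" for t
      by (rule has_vector_derivative_real_field) (use c in \<open>auto intro!: derivative_eq_intros\<close>)
  qed (auto intro!: continuous_intros)
  also have "exp (c * complex_of_real 1) = cis (2 * pi * real_of_int k)"
    using cis_eq[of 1] by simp
  finally show ?thesis using False by (simp add: cis_multiple_2pi)
qed

lemma integral_fchar:
  "(LINT x|unit_cube d. fchar d h x) = (if \<forall>j\<in>{1..d}. h j = 0 then 1 else 0)"
proof -
  have "fchar d h x = (\<Prod>j=1..d. cis (2 * pi * (real_of_int (h j) * x j)))" for x
  proof -
    have "fchar d h x = cis (\<Sum>j=1..d. 2 * pi * (real_of_int (h j) * x j))"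
      by (simp add: fchar_def dotp_def sum_distrib_left)
    also have "\<dots> = (\<Prod>j=1..d. cis (2 * pi * (real_of_int (h j) * x j)))"
      by (simp add: cis_conv_exp sum_distrib_left exp_sum)
    finally show ?thesis .
  qed
  then have "(LINT x|unit_cube d. fchar d h x) =
      (\<integral>x. (\<Prod>j\<in>{1..d}. (\<lambda>j t. cis (2 * pi * (real_of_int (h j) * t))) j (x j)) \<partial>unit_cube d)"
    by simp
  also have "\<dots> = (\<Prod>j=1..d. LINT t|unit_interval. cis (2 * pi * (real_of_int (h j) * t)))"
    unfolding unit_cube_def
  proof (rule unit_cube.product_integral_prod)
    fix j
    have "(\<lambda>t. cis (2 * pi * (real_of_int (h j) * t))) \<in> borel_measurable borel"
      by (intro borel_measurable_continuous_onI) (auto simp: cis_conv_exp intro!: continuous_intros)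
    then show "integrable unit_interval (\<lambda>t. cis (2 * pi * (real_of_int (h j) * t)))"
      by (intro unit_interval.integrable_const_bound[where B = 1] measurable_restrict_space1) auto
  qed simp
  also have "\<dots> = (if \<forall>j\<in>{1..d}. h j = 0 then 1 else 0)"
    unfolding integral_cis_unit_interval by (auto simp: prod_zero_iff)
  finally show ?thesis .
qed

lemma integral_fchar_orthogonal:
  assumes "h \<in> int_vecs d" "l \<in> int_vecs d"
  shows "(LINT x|unit_cube d. fchar d l x * cis (- (2 * pi * dotp d h x))) = (if l = h then 1 else 0)"
proof -
  have "(\<forall>j\<in>{1..d}. l j = h j) \<longleftrightarrow> l = h"
    using assms by (auto simp: int_vecs_def intro: PiE_ext)
  moreover have "(\<forall>j\<in>{1..d}. (\<lambda>j\<in>{1..d}. l j + (\<lambda>j\<in>{1..d}. - h j) j) j = 0) \<longleftrightarrow> (\<forall>j\<in>{1..d}. l j = h j)"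
    by (intro ball_cong) auto
  ultimately show ?thesis
    unfolding fchar_uminus[symmetric] fchar_mult integral_fchar by (simp only:)
qed

section \<open>Trigonometric polynomials and their uniform density\<close>

inductive trig_poly :: "nat \<Rightarrow> ((nat \<Rightarrow> real) \<Rightarrow> complex) \<Rightarrow> bool" for d where
  monom: "h \<in> int_vecs d \<Longrightarrow> trig_poly d (\<lambda>x. c * fchar d h x)"
| add: "trig_poly d p \<Longrightarrow> trig_poly d q \<Longrightarrow> trig_poly d (\<lambda>x. p x + q x)"

lemma trig_poly_mult:
  assumes "trig_poly d p" "trig_poly d q"
  shows "trig_poly d (\<lambda>x. p x * q x)"
  using assms
proof (induction p rule: trig_poly.induct)
  case (monom h c)
  from monom(2) show ?case
  proof (induction q rule: trig_poly.induct)
    case (monom l c')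
    have "trig_poly d (\<lambda>x. (c * c') * fchar d (\<lambda>j\<in>{1..d}. h j + l j) x)"
      by (intro trig_poly.monom) (auto simp: int_vecs_def)
    then show ?case by (simp only: fchar_mult[symmetric] mult_ac)
  next
    case (add p q)
    then show ?case using trig_poly.add by (fastforce simp: distrib_left)
  qed
next
  case (add p q')
  then show ?case using trig_poly.add[of d "\<lambda>x. p x * q x" "\<lambda>x. q' x * q x"] by (simp add: distrib_right)
qed

lemma trig_poly_const: "trig_poly d (\<lambda>x. c)"
proof -
  have "fchar d (\<lambda>j\<in>{1..d}. 0) x = 1" for x
    by (simp add: fchar_def dotp_def)
  then show ?thesis using trig_poly.monom[of "\<lambda>j\<in>{1..d}. 0" d c] by (simp add: int_vecs_def)
qed

text \<open>These functions separate the points of the torus. They are the usual combinations of the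
  characters with frequencies 1 and -1 in coordinate \<open>j\<close>.\<close>

lemma trig_poly_coordinate:
  assumes "j \<in> {1..d}"
  shows "trig_poly d (\<lambda>x. of_real (Re (cis (2 * pi * x j))))"
    and "trig_poly d (\<lambda>x. of_real (Im (cis (2 * pi * x j))))"
proof -
  define e where "e s = (\<lambda>i\<in>{1..d}. if i = j then s else 0)" for s :: int
  have e: "e s \<in> int_vecs d" for s by (auto simp: e_def int_vecs_def)
  have "dotp d (e s) x = real_of_int s * x j" for s x
  proof -
    have "dotp d (e s) x = (\<Sum>i=1..d. if i = j then real_of_int s * x i else 0)"
      unfolding dotp_def e_def by (intro sum.cong) auto
    then show ?thesis using assms by simp
  qed
  then have fe: "fchar d (e 1) x = cis (2 * pi * x j)" "fchar d (e (-1)) x = cnj (cis (2 * pi * x j))" for x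
    by (simp_all add: fchar_def cis_cnj)
  have "trig_poly d (\<lambda>x. 1 / 2 * fchar d (e 1) x + 1 / 2 * fchar d (e (-1)) x)"
    by (intro trig_poly.intros e)
  then show "trig_poly d (\<lambda>x. of_real (Re (cis (2 * pi * x j))))"
    by (rule back_subst[of "trig_poly d"]) (simp add: fe complex_eq_iff fun_eq_iff)
  have "trig_poly d (\<lambda>x. (- \<i> / 2) * fchar d (e 1) x + (\<i> / 2) * fchar d (e (-1)) x)"
    by (intro trig_poly.intros e)
  then show "trig_poly d (\<lambda>x. of_real (Im (cis (2 * pi * x j))))"
    by (rule back_subst[of "trig_poly d"]) (simp add: fe complex_eq_iff fun_eq_iff)
qed

lemma continuous_on_trig_poly: "trig_poly d p \<Longrightarrow> continuous_on A p"
  by (induction p rule: trig_poly.induct) (auto intro!: continuous_intros continuous_on_fchar)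

text \<open>
  Stone-Weierstrass is applied on the torus, the image of the cube under \<open>torus_map\<close>: on the
  cube itself the trigonometric polynomials do not separate opposite faces.
\<close>

definition torus_map :: "nat \<Rightarrow> (nat \<Rightarrow> real) \<Rightarrow> nat \<Rightarrow> complex" where
  "torus_map d x j = (if j \<in> {1..d} then cis (2 * pi * x j) else 1)"

lemma continuous_on_torus_map: "continuous_on A (torus_map d)"
proof (rule continuous_on_coordinatewise_then_product)
  fix j
  have "continuous_on A (\<lambda>x. cis (2 * pi * x j))"
    unfolding cis_conv_exp
    by (intro continuous_intros continuous_on_product_then_coordinatewise[where f = "\<lambda>x. x"])
  then show "continuous_on A (\<lambda>x. torus_map d x j)"
    unfolding torus_map_def by (cases "j \<in> {1..d}") auto
qed

lemma torus_map_eqD: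
  assumes "torus_map d x = torus_map d y" "j \<in> {1..d}"
  shows "x j - y j \<in> \<int>"
proof -
  have "cis (2 * pi * x j) = cis (2 * pi * y j)"
    using fun_cong[OF assms(1), of j] assms(2) by (simp add: torus_map_def)
  then have "sin (2 * pi * x j) = sin (2 * pi * y j) \<and> cos (2 * pi * x j) = cos (2 * pi * y j)"
    by (simp add: complex_eq_iff)
  then obtain n :: int where "2 * pi * x j = 2 * pi * y j + 2 * pi * real_of_int n"
    unfolding sin_cos_eq_iff by blast
  then have "2 * pi * x j = 2 * pi * (y j + real_of_int n)" by (simp add: distrib_left)
  then have "x j - y j = real_of_int n" by simp
  then show ?thesis by simp
qed

lemma trig_poly_approx:
  assumes u: "continuous_periodic d u" and e: "e > 0"
  shows "\<exists>p. trig_poly d p \<and> (\<forall>x\<in>cube d. cmod (of_real (u x) - p x) < e)"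
proof -
  define K where "K = torus_map d ` cube d"
  \<comment> \<open>The function on the torus induced by \<open>u\<close>, evaluated at an
    arbitrarily chosen preimage. Periodicity of \<open>u\<close> makes the choice
    irrelevant.\<close>
  define \<phi> where "\<phi> w = u (inv_into (cube d) (torus_map d) w)" for w
  \<comment> \<open>The algebra for Stone-Weierstrass: real continuous functions on the torus whose
    pullback to the cube is a trigonometric polynomial.\<close>
  define P where "P \<psi> \<longleftrightarrow> continuous_on K \<psi> \<and>
      (\<exists>p. trig_poly d p \<and> (\<forall>x\<in>cube d. complex_of_real (\<psi> (torus_map d x)) = p x))" for \<psi>
  have contu: "continuous_on (cube d) u" using u unfolding continuous_periodic_def by blast
  have K: "compact K"
    unfolding K_def by (intro compact_continuous_image continuous_on_torus_map compact_cube)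
  have \<phi>: "\<phi> (torus_map d x) = u x" if x: "x \<in> cube d" for x
  proof -
    let ?y = "inv_into (cube d) (torus_map d) (torus_map d x)"
    have "?y \<in> cube d" "torus_map d ?y = torus_map d x"
      using imageI[OF x, of "torus_map d"] by (rule inv_into_into, rule f_inv_into_f)
    then show ?thesis
      using u x torus_map_eqD[of d ?y x] unfolding continuous_periodic_def \<phi>_def by blast
  qed
  \<comment> \<open>The torus carries the quotient topology: the preimage of a closed set under
    \<open>\<phi>\<close> is the image of a compact part of the cube, hence closed.\<close>
  have cont\<phi>: "continuous_on K \<phi>"
  proof -
    have "closed (\<phi> -` B \<inter> K)" if "closed B" for B
    proof -
      have "\<phi> -` B \<inter> K = torus_map d ` (cube d \<inter> u -` B)"
        using \<phi> by (auto simp: K_def)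
      moreover have "compact (cube d \<inter> (cube d \<inter> u -` B))"
        by (rule compact_Int_closed[OF compact_cube continuous_closed_preimage[OF contu
              compact_imp_closed[OF compact_cube] that]])
      then have "compact (torus_map d ` (cube d \<inter> u -` B))"
        unfolding Int_left_absorb by (rule compact_continuous_image[OF continuous_on_torus_map])
      ultimately show ?thesis by (simp add: compact_imp_closed)
    qed
    then show ?thesis using continuous_on_closed_vimage[OF compact_imp_closed[OF K]] by blast
  qed
  have "\<exists>g. P g \<and> (\<forall>w\<in>K. \<bar>\<phi> w - g w\<bar> < e)"
  proof (rule Stone_Weierstrass_HOL[OF K])
    show "P (\<lambda>x. c)" for c unfolding P_def
      by (intro conjI continuous_on_const exI[where x = "\<lambda>x. of_real c"] trig_poly_const) simp
    show "continuous_on K f" if "P f" for f using that by (simp add: P_def)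
    show "P (\<lambda>x. f x + g x)" if "P f \<and> P g" for f g
    proof -
      from that obtain p q where "trig_poly d p" "trig_poly d q"
        "\<forall>x\<in>cube d. complex_of_real (f (torus_map d x)) = p x"
        "\<forall>x\<in>cube d. complex_of_real (g (torus_map d x)) = q x" unfolding P_def by blast
      with that show ?thesis unfolding P_def
        by (intro conjI continuous_intros exI[where x = "\<lambda>x. p x + q x"] trig_poly.add) auto
    qed
    show "P (\<lambda>x. f x * g x)" if "P f \<and> P g" for f g
    proof -
      from that obtain p q where "trig_poly d p" "trig_poly d q"
        "\<forall>x\<in>cube d. complex_of_real (f (torus_map d x)) = p x"
        "\<forall>x\<in>cube d. complex_of_real (g (torus_map d x)) = q x" unfolding P_def by blast
      with that show ?thesis unfolding P_def
        by (intro conjI continuous_intros exI[where x = "\<lambda>x. p x * q x"] trig_poly_mult) auto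
    qed
    show "\<exists>f. P f \<and> f w \<noteq> f w'" if "w \<in> K \<and> w' \<in> K \<and> w \<noteq> w'" for w w'
    proof -
      from that have "w \<noteq> w'" by blast
      then obtain j where j: "w j \<noteq> w' j" by (auto simp: fun_eq_iff)
      \<comment> \<open>Outside \<open>{1..d}\<close> all points of the torus have the coordinate
        1.\<close>
      then have jd: "j \<in> {1..d}" using that by (auto simp: K_def torus_map_def split: if_splits)
      have contj: "continuous_on K (\<lambda>w. w j)"
        by (rule continuous_on_product_then_coordinatewise) (rule continuous_on_id)
      have "P (\<lambda>w. Re (w j))" unfolding P_def
      proof (intro conjI exI)
        show "continuous_on K (\<lambda>w. Re (w j))" by (intro continuous_intros contj)
        show "\<forall>x\<in>cube d. complex_of_real (Re (torus_map d x j)) = of_real (Re (cis (2 * pi * x j)))"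
          using jd by (simp add: torus_map_def)
      qed (rule trig_poly_coordinate(1)[OF jd])
      moreover have "P (\<lambda>w. Im (w j))" unfolding P_def
      proof (intro conjI exI)
        show "continuous_on K (\<lambda>w. Im (w j))" by (intro continuous_intros contj)
        show "\<forall>x\<in>cube d. complex_of_real (Im (torus_map d x j)) = of_real (Im (cis (2 * pi * x j)))"
          using jd by (simp add: torus_map_def)
      qed (rule trig_poly_coordinate(2)[OF jd])
      moreover have "Re (w j) \<noteq> Re (w' j) \<or> Im (w j) \<noteq> Im (w' j)" using j by (simp add: complex_eq_iff)
      ultimately show ?thesis by blast
    qed
  qed (use cont\<phi> e in auto)
  then obtain g where "P g" and close: "\<And>w. w \<in> K \<Longrightarrow> \<bar>\<phi> w - g w\<bar> < e" by blast
  from \<open>P g\<close> obtain p where "trig_poly d p" and p: "\<And>x. x \<in> cube d \<Longrightarrow> complex_of_real (g (torus_map d x)) = p x"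
    unfolding P_def by blast
  moreover have "cmod (of_real (u x) - p x) < e" if "x \<in> cube d" for x
    using close[of "torus_map d x"] \<phi>[OF that] that
    by (simp add: p[OF that, symmetric] K_def flip: of_real_diff)
  ultimately show ?thesis by blast
qed

section \<open>Uniqueness of Fourier coefficients and the inversion formula\<close>

lemma emeasure_unit_interval_open_pos:
  assumes "open U" "t \<in> U" "t \<in> {0..1}"
  shows "emeasure unit_interval (U \<inter> {0..1}) > 0"
proof -
  obtain e where e: "e > 0" "ball t e \<subseteq> U" using assms by (meson open_contains_ball)
  \<comment> \<open>The interval is clipped to the unit interval, since \<open>t\<close> may be an
    endpoint.\<close>
  define a b where "a = max 0 (t - e)" and "b = min 1 (t + e)"
  have ab: "a < b" using e assms(3) by (auto simp: a_def b_def)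
  have "{a<..<b} \<subseteq> ball t e" by (auto simp: a_def b_def dist_real_def)
  then have sub: "{a<..<b} \<subseteq> U \<inter> {0..1}" using e by (auto simp: a_def b_def)
  have "0 < emeasure lborel {a<..<b}" using ab by simp
  also have "\<dots> \<le> emeasure lborel (U \<inter> {0..1})"
    by (rule emeasure_mono[OF sub]) (use assms(1) in simp)
  also have "\<dots> = emeasure unit_interval (U \<inter> {0..1})"
    by (rule emeasure_restrict_space[symmetric]) auto
  finally show ?thesis .
qed

text \<open>A basic open box around \<open>x\<close> is cut down to the cube. Its measure is a
  finite product of positive lengths.\<close>

lemma emeasure_unit_cube_open_pos:
  assumes "open U" "x \<in> U" "x \<in> cube d"
  obtains B where "B \<in> sets (unit_cube d)" "B \<subseteq> cube d \<inter> U" "emeasure (unit_cube d) B > 0"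
proof -
  have "openin (product_topology (\<lambda>_. euclidean) UNIV) U"
    using assms(1) by (simp add: euclidean_product_topology)
  then obtain X where X: "x \<in> Pi\<^sub>E UNIV X" "\<And>i. open (X i)" "Pi\<^sub>E UNIV X \<subseteq> U"
    using product_topology_open_contains_basis[of "\<lambda>_. euclidean" UNIV U x] assms(2) by auto
  define B where "B = Pi\<^sub>E {1..d} (\<lambda>j. X j \<inter> {0..1})"
  have meas: "X j \<inter> {0..1} \<in> sets unit_interval" for j
    by (subst sets_restrict_space_iff) (use X(2) in auto)
  have "B \<in> sets (unit_cube d)"
    unfolding B_def unit_cube_def by (intro sets_PiM_I_finite) (use meas in auto)
  moreover have "B \<subseteq> cube d \<inter> U"
  proof
    fix y assume y: "y \<in> B"
    then have "y \<in> cube d" unfolding B_def cube_eq by auto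
    moreover have "y j \<in> X j" for j
    proof (cases "j \<in> {1..d}")
      \<comment> \<open>Outside \<open>{1..d}\<close> both \<open>y\<close> and \<open>x\<close>
        have the value \<open>undefined\<close>, so membership is inherited from
        \<open>x\<close>.\<close>
      case False
      then have "y j = x j" using y assms(3) unfolding B_def cube_eq by (auto simp: PiE_iff extensional_def)
      then show ?thesis using X(1) by auto
    qed (use y in \<open>auto simp: B_def\<close>)
    ultimately show "y \<in> cube d \<inter> U" using X(3) by auto
  qed
  moreover have "emeasure (unit_cube d) B = (\<Prod>j\<in>{1..d}. emeasure unit_interval (X j \<inter> {0..1}))"
    unfolding B_def unit_cube_def by (rule unit_cube.emeasure_PiM) (use meas in auto)
  then have "emeasure (unit_cube d) B \<noteq> 0"
    using emeasure_unit_interval_open_pos[OF X(2)] X(1) assms(3)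
    by (auto simp: cube_eq PiE_iff prod_zero_iff dest!: bspec) (metis less_irrefl)
  then have "emeasure (unit_cube d) B > 0" by (simp add: zero_less_iff_neq_zero)
  ultimately show ?thesis by (rule that)
qed

text \<open>If \<open>H x\<close> were positive, \<open>H\<close> would be positive on a relatively
  open neighbourhood of \<open>x\<close>. This contains a box of positive measure, whereas
  \<open>H\<close> vanishes almost everywhere.\<close>

lemma continuous_on_cube_integral_zero_imp_zero:
  fixes H :: "(nat \<Rightarrow> real) \<Rightarrow> real"
  assumes cont: "continuous_on (cube d) H" and nonneg: "\<And>x. x \<in> cube d \<Longrightarrow> H x \<ge> 0"
    and int: "(LINT x|unit_cube d. H x) = 0" and x: "x \<in> cube d"
  shows "H x = 0"
proof (rule ccontr)
  assume "H x \<noteq> 0"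
  then have pos: "H x > 0" using nonneg[OF x] by simp
  have "AE y in unit_cube d. H y = 0"
    by (subst integral_nonneg_eq_0_iff_AE[symmetric])
      (use int nonneg in \<open>auto intro!: integrable_continuous_on_cube cont AE_I2\<close>)
  then obtain Z where Z: "{y \<in> cube d. H y \<noteq> 0} \<subseteq> Z" "Z \<in> sets (unit_cube d)" "emeasure (unit_cube d) Z = 0"
    by (auto elim!: AE_E)
  obtain U where U: "open U" "U \<inter> cube d = H -` {0<..} \<inter> cube d"
    using cont unfolding continuous_on_open_invariant by (meson open_greaterThan)
  have "x \<in> U" using U(2) pos x by auto
  then obtain B where B: "B \<in> sets (unit_cube d)" "B \<subseteq> cube d \<inter> U" "emeasure (unit_cube d) B > 0"
    using emeasure_unit_cube_open_pos[OF U(1) _ x] by blast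
  have "B \<subseteq> Z"
  proof
    fix y assume "y \<in> B"
    then have "y \<in> U \<inter> cube d" using B(2) by blast
    then have "y \<in> cube d" "H y > 0" unfolding U(2) by auto
    then show "y \<in> Z" using Z(1) by (simp add: subset_iff)
  qed
  then have "emeasure (unit_cube d) B \<le> emeasure (unit_cube d) Z" by (rule emeasure_mono) (rule Z)
  with B(3) Z(3) show False by simp
qed

text \<open>By linearity \<open>G\<close> integrates to 0 against every trigonometric polynomial.
  Approximating the conjugate of \<open>G\<close> uniformly by such polynomials shows that the
  integral of the squared modulus of \<open>G\<close> is 0. Real and imaginary parts are treated
  separately because the approximation result is for real functions.\<close>

lemma zero_fourier_coeffs_imp_zero:
  assumes cont: "continuous_on (cube d) G"
    and Re: "continuous_periodic d (\<lambda>x. Re (G x))" and Im: "continuous_periodic d (\<lambda>x. Im (G x))"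
    and zero: "\<And>h. h \<in> int_vecs d \<Longrightarrow> (LINT x|unit_cube d. G x * fchar d h x) = 0"
    and x: "x \<in> cube d"
  shows "G x = 0"
proof -
  have poly: "(LINT x|unit_cube d. G x * p x) = 0" if "trig_poly d p" for p
    using that
  proof (induction p rule: trig_poly.induct)
    case (monom h c)
    have "(LINT x|unit_cube d. G x * (c * fchar d h x)) = (LINT x|unit_cube d. c * (G x * fchar d h x))"
      by (simp add: mult.left_commute)
    then show ?case using zero[OF monom] by simp
  next
    case (add p q)
    have "integrable (unit_cube d) (\<lambda>x. G x * r x)" if "trig_poly d r" for r
      by (intro integrable_continuous_on_cube continuous_intros cont continuous_on_trig_poly[OF that])
    from this[OF add.hyps(1)] this[OF add.hyps(2)]
    have "(LINT x|unit_cube d. G x * (p x + q x)) = (LINT x|unit_cube d. G x * p x) + (LINT x|unit_cube d. G x * q x)"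
      unfolding distrib_left by (rule Bochner_Integration.integral_add)
    with add.IH show ?case by simp
  qed
  have "bounded (G ` cube d)"
    by (intro compact_imp_bounded compact_continuous_image cont compact_cube)
  then obtain B where "B > 0" and B: "\<And>x. x \<in> cube d \<Longrightarrow> cmod (G x) \<le> B"
    unfolding bounded_pos by auto
  have small: "cmod (LINT x|unit_cube d. G x * cnj (G x)) \<le> e" if "e > 0" for e
  proof -
    \<comment> \<open>Two approximations with error \<open>e'\<close> each are multiplied by
      \<open>G\<close>, which is bounded by \<open>B\<close>.\<close>
    define e' where "e' = e / (2 * B)"
    have e': "e' > 0" using that \<open>B > 0\<close> by (simp add: e'_def)
    obtain p where p: "trig_poly d p" "\<And>x. x \<in> cube d \<Longrightarrow> cmod (of_real (Re (G x)) - p x) < e'"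
      using trig_poly_approx[OF Re e'] by blast
    obtain q where q: "trig_poly d q" "\<And>x. x \<in> cube d \<Longrightarrow> cmod (of_real (Im (G x)) - q x) < e'"
      using trig_poly_approx[OF Im e'] by blast
    define r where "r x = p x + (- \<i>) * q x" for x
    have r: "trig_poly d r" unfolding r_def 
      by (rule trig_poly.add[OF p(1) trig_poly_mult[OF trig_poly_const q(1)]])
    have contr: "continuous_on (cube d) r" by (rule continuous_on_trig_poly[OF r])
    have close: "cmod (G x * cnj (G x) - G x * r x) \<le> e" if x: "x \<in> cube d" for x
    proof -
      have "cnj (G x) - r x = (of_real (Re (G x)) - p x) + (- \<i>) * (of_real (Im (G x)) - q x)"
        by (simp add: r_def complex_eq_iff)
      also have "cmod \<dots> \<le> e' + e'"
        by (rule norm_triangle_le) (use p(2)[OF x] q(2)[OF x] in \<open>simp add: norm_mult\<close>)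
      finally have "cmod (G x) * cmod (cnj (G x) - r x) \<le> B * (e' + e')"
        using B[OF x] \<open>B > 0\<close> by (intro mult_mono) auto
      also have "\<dots> = e" using \<open>B > 0\<close> by (simp add: e'_def)
      finally show ?thesis by (simp flip: norm_mult add: right_diff_distrib)
    qed
    have "(LINT x|unit_cube d. G x * cnj (G x)) = (LINT x|unit_cube d. G x * cnj (G x) - G x * r x)"
      by (subst Bochner_Integration.integral_diff)
        (auto intro!: integrable_continuous_on_cube continuous_intros cont contr simp: poly[OF r])
    also have "cmod \<dots> \<le> e"
      by (rule norm_integral_unit_cube_le)
        (auto intro!: continuous_intros cont contr close)
    finally show ?thesis .
  qed
  have "cmod (LINT x|unit_cube d. G x * cnj (G x)) \<le> 0"
    by (rule field_le_epsilon) (simp only: add_0 small)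
  then have "(LINT x|unit_cube d. complex_of_real ((cmod (G x))\<^sup>2)) = 0"
    by (simp only: complex_norm_square norm_le_zero_iff)
  then have "(LINT x|unit_cube d. (cmod (G x))\<^sup>2) = 0"
    by (simp only: integral_complex_of_real of_real_eq_0_iff)
  then have "(cmod (G x))\<^sup>2 = 0"
    by (intro continuous_on_cube_integral_zero_imp_zero[where H = "\<lambda>x. (cmod (G x))\<^sup>2", OF _ _ _ x])
      (auto intro!: continuous_intros cont)
  then show ?thesis by simp
qed

text \<open>Absolute summability makes the Fourier series converge uniformly to a continuous
  periodic \<open>S\<close>. Integrating term by term shows that \<open>S\<close> has the same
  coefficients as \<open>f\<close>, so the difference vanishes by uniqueness.\<close>

lemma fourier_inversion:
  assumes f: "continuous_periodic d f"
    and summ: "(\<lambda>h. cmod (fourier_coeff d f h)) summable_on int_vecs d" and x: "x \<in> cube d"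
  shows "((\<lambda>h. fourier_coeff d f h * fchar d h x) has_sum of_real (f x)) (int_vecs d)"
proof -
  define c where "c h = fourier_coeff d f h" for h
  define S where "S x = (\<Sum>\<^sub>\<infinity>h\<in>int_vecs d. c h * fchar d h x)" for x
  have summ_x: "(\<lambda>h. c h * fchar d h x) summable_on int_vecs d" for x
    by (rule abs_summable_summable) (use summ in \<open>simp add: c_def norm_mult\<close>)
  have lim: "uniform_limit (cube d) (\<lambda>F x. \<Sum>h\<in>F. c h * fchar d h x) S (finite_subsets_at_top (int_vecs d))"
    unfolding S_def by (rule Weierstrass_m_test_general[OF _ summ]) (simp add: c_def norm_mult)
  have cont: "continuous_on (cube d) S"
    by (rule uniform_limit_theorem[OF always_eventually lim finite_subsets_at_top_neq_bot])
      (intro allI continuous_intros continuous_on_fchar)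
  have contf: "continuous_on (cube d) f" using f unfolding continuous_periodic_def by blast
  have contF: "continuous_on (cube d) (\<lambda>x. complex_of_real (f x))" by (intro continuous_intros contf)
  have coeff: "(LINT x|unit_cube d. S x * cis (- (2 * pi * dotp d h x))) = c h" if h: "h \<in> int_vecs d" for h
  proof -
    have contE: "continuous_on A (\<lambda>x. cis (- (2 * pi * dotp d h x)))" for A
      unfolding fchar_uminus[symmetric] by (rule continuous_on_fchar)
    have small: "cmod ((LINT x|unit_cube d. S x * cis (- (2 * pi * dotp d h x))) - c h) \<le> e" if e: "e > 0" for e
    proof -
      have "\<forall>\<^sub>F F in finite_subsets_at_top (int_vecs d). \<forall>x\<in>cube d. dist (\<Sum>h\<in>F. c h * fchar d h x) (S x) < e"
        using lim e by (rule uniform_limitD)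
      \<comment> \<open>The partial sum must include \<open>h\<close>; then orthogonality yields
        exactly \<open>c h\<close>.\<close>
      moreover have "\<forall>\<^sub>F F in finite_subsets_at_top (int_vecs d). finite F \<and> {h} \<subseteq> F \<and> F \<subseteq> int_vecs d"
        unfolding eventually_finite_subsets_at_top using h by (intro exI[of _ "{h}"]) simp
      ultimately have "\<forall>\<^sub>F F in finite_subsets_at_top (int_vecs d).
          (\<forall>x\<in>cube d. dist (\<Sum>h\<in>F. c h * fchar d h x) (S x) < e) \<and> (finite F \<and> {h} \<subseteq> F \<and> F \<subseteq> int_vecs d)"
        by (rule eventually_conj)
      from eventually_happens'[OF finite_subsets_at_top_neq_bot this]
      obtain F where F: "finite F" "h \<in> F" "F \<subseteq> int_vecs d"
        and close: "\<And>x. x \<in> cube d \<Longrightarrow> dist (\<Sum>h\<in>F. c h * fchar d h x) (S x) < e"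
        by blast
      define p where "p x = (\<Sum>h\<in>F. c h * fchar d h x)" for x
      have contp: "continuous_on (cube d) p" unfolding p_def by (intro continuous_intros continuous_on_fchar)
      have "(LINT x|unit_cube d. p x * cis (- (2 * pi * dotp d h x))) =
         (LINT x|unit_cube d. (\<Sum>l\<in>F. c l * (fchar d l x * cis (- (2 * pi * dotp d h x)))))"
        unfolding p_def sum_distrib_right by (simp add: mult.assoc)
      also have "\<dots> = (\<Sum>l\<in>F. c l * (LINT x|unit_cube d. fchar d l x * cis (- (2 * pi * dotp d h x))))"
        by (subst Bochner_Integration.integral_sum)
          (auto intro!: integrable_continuous_on_cube continuous_intros continuous_on_fchar contE)
      also have "\<dots> = (\<Sum>l\<in>F. if l = h then c l else 0)"
        using F h by (intro sum.cong) (auto simp: integral_fchar_orthogonal)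
      also have "\<dots> = c h" using F by simp
      finally have "(LINT x|unit_cube d. S x * cis (- (2 * pi * dotp d h x))) - c h =
         (LINT x|unit_cube d. S x * cis (- (2 * pi * dotp d h x)) - p x * cis (- (2 * pi * dotp d h x)))"
        by (subst Bochner_Integration.integral_diff)
          (auto intro!: integrable_continuous_on_cube continuous_intros cont contp contE)
      also have "cmod \<dots> \<le> e"
      proof (rule norm_integral_unit_cube_le)
        fix x assume "x \<in> cube d"
        then show "cmod (S x * cis (- (2 * pi * dotp d h x)) - p x * cis (- (2 * pi * dotp d h x))) \<le> e"
          using close[of x] unfolding left_diff_distrib[symmetric] norm_mult p_def
          by (simp add: dist_norm norm_minus_commute)
      qed (intro continuous_intros cont contp contE)
      finally show ?thesis .
    qed
    have "cmod ((LINT x|unit_cube d. S x * cis (- (2 * pi * dotp d h x))) - c h) \<le> 0"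
      by (rule field_le_epsilon) (simp only: add_0 small)
    then show ?thesis by simp
  qed
  define G where "G x = complex_of_real (f x) - S x" for x
  have contG: "continuous_on (cube d) G" unfolding G_def by (intro continuous_intros contF cont)
  have perG: "G x = G y" if "x \<in> cube d" "y \<in> cube d" "\<forall>j\<in>{1..d}. x j - y j \<in> \<int>" for x y
  proof -
    have "f x = f y" using f that unfolding continuous_periodic_def by blast
    moreover have "S x = S y"
      unfolding S_def using fchar_periodic[of d x y] that(3) by simp
    ultimately show ?thesis by (simp add: G_def)
  qed
  have "G x = 0"
  proof (rule zero_fourier_coeffs_imp_zero[OF contG _ _ _ x])
    show "continuous_periodic d (\<lambda>x. Re (G x))" "continuous_periodic d (\<lambda>x. Im (G x))"
      unfolding continuous_periodic_def
      by (intro conjI ballI impI continuous_intros contG; rule arg_cong[OF perG]; assumption)+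
    fix h assume h: "h \<in> int_vecs d"
    \<comment> \<open>Fourier coefficients integrate against conjugate characters, so the integral
      against \<open>fchar d h\<close> is the coefficient at the negated frequency.\<close>
    define h' where "h' = (\<lambda>j\<in>{1..d}. - h j)"
    have h': "h' \<in> int_vecs d" by (auto simp: h'_def int_vecs_def)
    have "dotp d h x = dotp d (\<lambda>j\<in>{1..d}. - h' j) x" for x
      by (rule dotp_cong) (simp add: h'_def)
    then have "fchar d h x = fchar d (\<lambda>j\<in>{1..d}. - h' j) x" for x
      by (simp only: fchar_def)
    then have eq: "fchar d h x = cis (- (2 * pi * dotp d h' x))" for x by (simp only: fchar_uminus)
    have "(LINT x|unit_cube d. G x * fchar d h x) =
       (LINT x|unit_cube d. complex_of_real (f x) * fchar d h x) - (LINT x|unit_cube d. S x * fchar d h x)"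
      unfolding G_def left_diff_distrib
      by (intro Bochner_Integration.integral_diff integrable_continuous_on_cube continuous_intros
          contF cont continuous_on_fchar)
    also have "\<dots> = 0" using coeff[OF h'] unfolding eq by (simp add: c_def fourier_coeff_def)
    finally show "(LINT x|unit_cube d. G x * fchar d h x) = 0" .
  qed
  then have "S x = of_real (f x)" by (simp add: G_def)
  moreover have "((\<lambda>h. c h * fchar d h x) has_sum S x) (int_vecs d)"
    unfolding S_def using summ_x by (rule has_sum_infsum)
  ultimately show ?thesis by (simp add: c_def)
qed

subsection \<open>Medians and random lattices\<close>

text \<open>Sorting permutes the list, so counting indices can be replaced by counting positions in
  the sorted list.\<close>

lemma card_filter_sort_map:
  "card {r\<in>{1..R}. P (Z r)} = card {i. i < R \<and> P (sort (map Z [1..<Suc R]) ! i)}"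
proof -
  have "card {r\<in>{1..R}. P (Z r)} = length (filter P (map Z [1..<Suc R]))"
  proof -
    have "{r\<in>{1..R}. P (Z r)} = set (filter (\<lambda>r. P (Z r)) [1..<Suc R])" by auto
    also have "card \<dots> = length (filter (\<lambda>r. P (Z r)) [1..<Suc R])"
      by (intro distinct_card distinct_filter) simp
    finally show ?thesis by (simp add: filter_map o_def del: upt_Suc)
  qed
  also have "\<dots> = length (filter P (sort (map Z [1..<Suc R])))"
    by (metis mset_filter mset_sort size_mset)
  also have "\<dots> = card {i. i < R \<and> P (sort (map Z [1..<Suc R]) ! i)}"
    by (simp add: length_filter_conv_card del: upt_Suc)
  finally show ?thesis .
qed

text \<open>If the middle entry of the sorted list were below \<open>a\<close>, only the later
  positions could hold values of at least \<open>a\<close>. There are \<open>R - R div 2 - 1\<close>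
  of these, which is at most \<open>R div 2\<close>.\<close>

lemma median_ge:
  assumes "R div 2 < card {r\<in>{1..R}. a \<le> Z r}"
  shows "a \<le> median R Z"
proof (rule ccontr)
  define xs where "xs = sort (map Z [1..<Suc R])"
  have len: "length xs = R" and sorted: "sorted xs" by (simp_all add: xs_def)
  assume "\<not> a \<le> median R Z"
  then have less: "xs ! (R div 2) < a" by (simp add: median_def xs_def)
  have "{i. i < R \<and> a \<le> xs ! i} \<subseteq> {R div 2 <..< R}"
  proof
    fix i assume i: "i \<in> {i. i < R \<and> a \<le> xs ! i}"
    have "R div 2 < i"
    proof (rule ccontr)
      assume "\<not> R div 2 < i"
      then have "xs ! i \<le> xs ! (R div 2)" using i len by (intro sorted_nth_mono sorted) auto
      with i less show False by auto
    qed
    with i show "i \<in> {R div 2 <..< R}" by auto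
  qed
  then have "card {i. i < R \<and> a \<le> xs ! i} \<le> card {R div 2 <..< R}" by (intro card_mono) auto
  then show False
    using assms card_filter_sort_map[of R "\<lambda>x. a \<le> x" Z] unfolding xs_def[symmetric] by simp
qed

lemma median_le:
  assumes "R div 2 < card {r\<in>{1..R}. Z r \<le> b}"
  shows "median R Z \<le> b"
proof (rule ccontr)
  define xs where "xs = sort (map Z [1..<Suc R])"
  have len: "length xs = R" and sorted: "sorted xs" by (simp_all add: xs_def)
  assume "\<not> median R Z \<le> b"
  then have less: "b < xs ! (R div 2)" by (simp add: median_def xs_def)
  have "{i. i < R \<and> xs ! i \<le> b} \<subseteq> {..<R div 2}"
  proof
    fix i assume i: "i \<in> {i. i < R \<and> xs ! i \<le> b}"
    have "i < R div 2"
    proof (rule ccontr)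
      assume "\<not> i < R div 2"
      then have "xs ! (R div 2) \<le> xs ! i" using i len by (intro sorted_nth_mono sorted) auto
      with i less show False by auto
    qed
    then show "i \<in> {..<R div 2}" by auto
  qed
  then have "card {i. i < R \<and> xs ! i \<le> b} \<le> card {..<R div 2}" by (intro card_mono) auto
  then show False
    using assms card_filter_sort_map[of R "\<lambda>x. x \<le> b" Z] unfolding xs_def[symmetric] by simp
qed

text \<open>A strict majority of values in the interval from \<open>c - b\<close> to
  \<open>c + b\<close> keeps the median there, whatever the other values are.\<close>

lemma abs_median_diff_le:
  assumes "G \<subseteq> {1..R}" "R div 2 < card G" "\<And>r. r \<in> G \<Longrightarrow> \<bar>Z r - c\<bar> \<le> b"
  shows "\<bar>median R Z - c\<bar> \<le> b"
proof -
  have "card G \<le> card {r\<in>{1..R}. c - b \<le> Z r}" "card G \<le> card {r\<in>{1..R}. Z r \<le> c + b}"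
    using assms(1,3) by (auto intro!: card_mono simp: abs_le_iff subset_iff) (metis add.commute diff_le_eq minus_diff_eq)+
  then show ?thesis
    using median_ge[of R "c - b" Z] median_le[of R Z "c + b"] assms(2) by (simp add: abs_le_iff)
qed

lemma cmod_cmedian_diff_le:
  assumes "G \<subseteq> {1..R}" "R div 2 < card G" "\<And>r. r \<in> G \<Longrightarrow> cmod (Z r - c) \<le> b"
  shows "cmod (cmedian R Z - c) \<le> 2 * b"
proof -
  have "\<bar>median R (\<lambda>r. Re (Z r)) - Re c\<bar> \<le> b"
    by (rule abs_median_diff_le[OF assms(1,2)])
      (use assms(3) abs_Re_le_cmod[of "Z _ - c"] in \<open>fastforce intro: order_trans\<close>)
  moreover have "\<bar>median R (\<lambda>r. Im (Z r)) - Im c\<bar> \<le> b"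
    by (rule abs_median_diff_le[OF assms(1,2)])
      (use assms(3) abs_Im_le_cmod[of "Z _ - c"] in \<open>fastforce intro: order_trans\<close>)
  ultimately show ?thesis
    using cmod_le[of "cmedian R Z - c"] by (simp add: cmedian_def)
qed

section \<open>The dual lattice of a rank-1 lattice with random generating vector\<close>

definition in_dual :: "nat \<Rightarrow> nat \<Rightarrow> (nat \<Rightarrow> nat) \<Rightarrow> (nat \<Rightarrow> int) \<Rightarrow> bool" where
  "in_dual d N z k \<longleftrightarrow> int N dvd (\<Sum>j=1..d. k j * int (z j))"

text \<open>Once the other coordinates are fixed, at most one value of \<open>z j\<close> solves the congruence.\<close>

lemma prob_in_dual_le:
  assumes N: "prime N" and j: "j \<in> {1..d}" "\<not> int N dvd k j"
  shows "measure_pmf.prob (pmf_of_set ({1..d} \<rightarrow>\<^sub>E {1..<N})) {z. in_dual d N z k} \<le> 1 / (real N - 1)"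
proof -
  define S where "S = ({1..d} \<rightarrow>\<^sub>E {1..<N})"
  define S' where "S' = (({1..d} - {j}) \<rightarrow>\<^sub>E {1..<N})"
  have N2: "N \<ge> 2" using N by (rule prime_ge_2_nat)
  have fin: "finite S" "finite S'" unfolding S_def S'_def by (auto intro!: finite_PiE)
  have card_S: "card S = (N - 1) ^ d" unfolding S_def by (subst card_PiE) auto
  have card_S': "card S' = (N - 1) ^ (d - 1)" unfolding S'_def using j by (subst card_PiE) auto
  have S_ne: "S \<noteq> {}" unfolding S_def using N2 by (auto simp: PiE_eq_empty_iff)
  have "inj_on (\<lambda>z. restrict z ({1..d} - {j})) (S \<inter> {z. in_dual d N z k})"
  proof (rule inj_onI)
    fix z z' assume z: "z \<in> S \<inter> {z. in_dual d N z k}" and z': "z' \<in> S \<inter> {z. in_dual d N z k}"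
      and eq: "restrict z ({1..d} - {j}) = restrict z' ({1..d} - {j})"
    have eq': "z i = z' i" if "i \<in> {1..d} - {j}" for i using fun_cong[OF eq, of i] that by simp
    have split: "(\<Sum>i=1..d. k i * int (y i)) = k j * int (y j) + (\<Sum>i\<in>{1..d}-{j}. k i * int (y i))" for y :: "nat \<Rightarrow> nat"
      by (rule sum.remove) (use j in auto)
    have "int N dvd (\<Sum>i=1..d. k i * int (z i)) - (\<Sum>i=1..d. k i * int (z' i))"
      using z z' by (intro dvd_diff) (auto simp: in_dual_def)
    also have "(\<Sum>i=1..d. k i * int (z i)) - (\<Sum>i=1..d. k i * int (z' i)) = k j * (int (z j) - int (z' j))"
      unfolding split using eq' by (simp add: algebra_simps)
    finally have "int N dvd int (z j) - int (z' j)"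
      using N j(2) by (simp add: prime_dvd_mult_iff)
    moreover have "z j \<in> {1..<N}" "z' j \<in> {1..<N}" using z z' j by (auto simp: S_def PiE_iff)
    then have "\<bar>int (z j) - int (z' j)\<bar> < int N" by auto
    ultimately have zj: "z j = z' j" using zdvd_not_zless[of "\<bar>int (z j) - int (z' j)\<bar>" "int N"] by auto
    show "z = z'"
    proof (rule PiE_ext)
      show "z \<in> {1..d} \<rightarrow>\<^sub>E {1..<N}" "z' \<in> {1..d} \<rightarrow>\<^sub>E {1..<N}" using z z' by (auto simp: S_def)
      show "z i = z' i" if "i \<in> {1..d}" for i using eq' zj that by (cases "i = j") auto
    qed
  qed
  then have "card (S \<inter> {z. in_dual d N z k}) \<le> card S'"
  proof (rule card_inj_on_le)
    show "(\<lambda>z. restrict z ({1..d} - {j})) ` (S \<inter> {z. in_dual d N z k}) \<subseteq> S'"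
      unfolding S_def S'_def by (auto intro!: restrict_PiE_iff[THEN iffD2])
  qed (rule fin)
  then have "real (card (S \<inter> {z. in_dual d N z k})) / real (card S) \<le> real (card S') / real (card S)"
    by (intro divide_right_mono) auto
  also have "\<dots> = 1 / (real N - 1)"
  proof -
    have "d = Suc (d - 1)" using j by auto
    then have "card S = (N - 1) * card S'" unfolding card_S card_S' by (metis power_Suc)
    moreover have "card S' > 0" unfolding card_S' using N2 by simp
    ultimately show ?thesis using N2 by (simp add: of_nat_diff)
  qed
  finally show ?thesis using S_ne fin unfolding S_def by (subst measure_pmf_of_set) auto
qed

text \<open>Union bound over the \<open>k\<close>-element sets of indices whose draws all fall into
  \<open>A\<close>; by independence each such event has probability at most
  \<open>t ^ k\<close>.\<close>

lemma prob_many_of_iid_le: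
  assumes "measure_pmf.prob p A \<le> t"
  shows "measure_pmf.prob (Pi_pmf {1..R} dflt (\<lambda>_. p)) {z. k \<le> card {r\<in>{1..R}. z r \<in> A}} \<le>
         real (R choose k) * t ^ k"
proof -
  define F where "F = {S. S \<subseteq> {1..R} \<and> card S = k}"
  have fin: "finite F" unfolding F_def by auto
  let ?M = "measure_pmf (Pi_pmf {1..R} dflt (\<lambda>_. p))"
  have t: "t \<ge> 0" using assms measure_nonneg order_trans by blast
  have "{z. k \<le> card {r\<in>{1..R}. z r \<in> A}} \<subseteq> (\<Union>S\<in>F. Pi S (\<lambda>_. A))"
  proof
    fix z assume "z \<in> {z. k \<le> card {r\<in>{1..R}. z r \<in> A}}"
    then obtain S where "S \<subseteq> {r\<in>{1..R}. z r \<in> A}" "card S = k"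
      by (auto elim: obtain_subset_with_card_n)
    then have "S \<in> F" "z \<in> Pi S (\<lambda>_. A)" by (auto simp: F_def)
    then show "z \<in> (\<Union>S\<in>F. Pi S (\<lambda>_. A))" by blast
  qed
  then have "measure ?M {z. k \<le> card {r\<in>{1..R}. z r \<in> A}} \<le> measure ?M (\<Union>S\<in>F. Pi S (\<lambda>_. A))"
    by (intro measure_pmf.finite_measure_mono) auto
  also have "\<dots> \<le> (\<Sum>S\<in>F. measure ?M (Pi S (\<lambda>_. A)))"
    by (intro measure_UNION_le fin) auto
  also have "\<dots> \<le> (\<Sum>S\<in>F. t ^ k)"
  proof (rule sum_mono)
    fix S assume S: "S \<in> F"
    \<comment> \<open>Indices outside \<open>S\<close> receive the trivial condition, so that the
      product formula over all of \<open>{1..R}\<close> applies.\<close>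
    have "Pi S (\<lambda>_. A) = Pi {1..R} (\<lambda>r. if r \<in> S then A else UNIV)"
      using S by (auto simp: F_def Pi_iff split: if_splits)
    then have "measure ?M (Pi S (\<lambda>_. A)) =
        (\<Prod>r\<in>{1..R}. measure_pmf.prob p (if r \<in> S then A else UNIV))"
      by (simp add: measure_Pi_pmf_Pi)
    also have "\<dots> = (\<Prod>r\<in>{1..R}. if r \<in> S then measure_pmf.prob p A else 1)"
      by (intro prod.cong) auto
    also have "\<dots> = measure_pmf.prob p A ^ k"
      using S by (subst prod.inter_restrict[symmetric]) (auto simp: F_def Int_absorb1)
    also have "\<dots> \<le> t ^ k" by (intro power_mono assms) auto
    finally show "measure ?M (Pi S (\<lambda>_. A)) \<le> t ^ k" .
  qed
  also have "\<dots> = real (R choose k) * t ^ k" unfolding F_def by (simp add: n_subsets)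
  finally show ?thesis .
qed

subsection \<open>Aliasing\<close>

lemma has_sum_finite_sum:
  fixes f :: "'k \<Rightarrow> 'a \<Rightarrow> 'b::topological_comm_monoid_add"
  assumes "finite K" "\<And>k. k \<in> K \<Longrightarrow> (f k has_sum s k) A"
  shows "((\<lambda>x. \<Sum>k\<in>K. f k x) has_sum (\<Sum>k\<in>K. s k)) A"
  using assms by (induction K rule: finite_induct) (auto intro: has_sum_add)

lemma sum_roots_of_unity:
  assumes "N > 0"
  shows "(\<Sum>k<N. cis (2 * pi * (real k * real_of_int m / real N))) = (if int N dvd m then of_nat N else 0)"
proof -
  define w where "w = cis (2 * pi * real_of_int m / real N)"
  have pow: "cis (2 * pi * (real k * real_of_int m / real N)) = w ^ k" for k
    unfolding w_def Complex.DeMoivre by (simp add: field_simps)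
  have wN: "w ^ N = 1"
    using assms by (simp add: w_def Complex.DeMoivre cis_multiple_2pi)
  have w1: "w = 1 \<longleftrightarrow> int N dvd m"
  proof
    assume "w = 1"
    then have "sin (2 * pi * real_of_int m / real N) = sin 0 \<and> cos (2 * pi * real_of_int m / real N) = cos 0"
      by (simp add: w_def complex_eq_iff)
    then obtain n :: int where "2 * pi * real_of_int m / real N = 0 + 2 * pi * real_of_int n"
      unfolding sin_cos_eq_iff by blast
    then have "real_of_int m = real_of_int (int N * n)" using assms by (simp add: field_simps)
    then have "m = int N * n" by (simp only: of_int_eq_iff)
    then show "int N dvd m" by simp
  next
    assume "int N dvd m"
    then obtain n where "m = int N * n" by blast
    then have "2 * pi * real_of_int m / real N = 2 * pi * real_of_int n" using assms by simp
    then show "w = 1" by (simp add: w_def cis_multiple_2pi)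
  qed
  show ?thesis unfolding pow
  proof (cases "w = 1")
    case True
    then show "(\<Sum>k<N. w ^ k) = (if int N dvd m then of_nat N else 0)" using w1 by simp
  next
    case False
    then show "(\<Sum>k<N. w ^ k) = (if int N dvd m then of_nat N else 0)"
      using w1 by (simp add: geometric_sum wN)
  qed
qed

text \<open>The characters of these frequencies agree with that of \<open>h\<close> at all lattice
  points, so sampling there cannot tell them apart.\<close>

definition aliases :: "nat \<Rightarrow> nat \<Rightarrow> (nat \<Rightarrow> nat) \<Rightarrow> (nat \<Rightarrow> int) \<Rightarrow> (nat \<Rightarrow> int) set" where
  "aliases d N z h = {l \<in> int_vecs d. in_dual d N z (\<lambda>j. l j - h j)}"

text \<open>The Fourier series is inserted at each lattice point, and the finite sum over the points
  is moved inside the series. For each frequency it becomes a sum of roots of unity, which survives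
  exactly on the alias class.\<close>

lemma lattice_coeff_has_sum:
  assumes N: "N > 0" and f: "continuous_periodic d f"
    and summ: "(\<lambda>h. cmod (fourier_coeff d f h)) summable_on int_vecs d"
  shows "(fourier_coeff d f has_sum lattice_coeff d N z f h) (aliases d N z h)"
proof -
  define u where "u = (\<lambda>k j. real k * real (z j) / real N)"
  define y where "y k = (\<lambda>j\<in>{1..d}. frac (u k j))" for k
  define m where "m l = (\<Sum>j=1..d. (l j - h j) * int (z j))" for l
  have point: "((\<lambda>l. fourier_coeff d f l * cis (2 * pi * (real k * real_of_int (m l) / real N))) has_sum
      of_real (f (y k)) * cis (- (2 * pi * dotp d h (u k)))) (int_vecs d)" for k
  proof -
    have "y k \<in> cube d" by (auto simp: cube_eq y_def frac_ge_0 less_imp_le[OF frac_lt_1])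
    from fourier_inversion[OF f summ this]
    have "((\<lambda>l. fourier_coeff d f l * fchar d l (y k) * cis (- (2 * pi * dotp d h (u k)))) has_sum
        of_real (f (y k)) * cis (- (2 * pi * dotp d h (u k)))) (int_vecs d)"
      by (rule has_sum_cmult_left)
    moreover have "fchar d l (y k) * cis (- (2 * pi * dotp d h (u k))) =
        cis (2 * pi * (real k * real_of_int (m l) / real N))" for l
    proof -
      \<comment> \<open>The inversion formula is used at the reduced point in the cube; periodicity
        of the characters then removes the fractional parts.\<close>
      have "fchar d l (y k) = fchar d l (u k)"
        by (rule fchar_periodic) (simp add: y_def frac_def)
      moreover have "dotp d l (u k) - dotp d h (u k) = real k * real_of_int (m l) / real N"
        unfolding dotp_def u_def m_def sum_subtractf[symmetric] of_int_sum sum_distrib_left sum_divide_distrib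
        by (intro sum.cong) (auto simp: algebra_simps diff_divide_distrib)
      then have "2 * pi * dotp d l (u k) + - (2 * pi * dotp d h (u k)) = 2 * pi * (real k * real_of_int (m l) / real N)"
        by (metis add_uminus_conv_diff right_diff_distrib)
      ultimately show ?thesis by (simp add: fchar_def cis_mult)
    qed
    ultimately show ?thesis by (simp only: mult.assoc)
  qed
  have "((\<lambda>l. (\<Sum>k<N. fourier_coeff d f l * cis (2 * pi * (real k * real_of_int (m l) / real N))) / of_nat N) has_sum
     (\<Sum>k<N. of_real (f (y k)) * cis (- (2 * pi * dotp d h (u k)))) / of_nat N) (int_vecs d)"
    by (intro has_sum_divide_const has_sum_finite_sum point) simp
  moreover have "(\<Sum>k<N. of_real (f (y k)) * cis (- (2 * pi * dotp d h (u k)))) / of_nat N = lattice_coeff d N z f h"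
    by (simp add: lattice_coeff_def y_def u_def)
  moreover have "(\<Sum>k<N. fourier_coeff d f l * cis (2 * pi * (real k * real_of_int (m l) / real N))) / of_nat N =
     (if int N dvd m l then fourier_coeff d f l else 0)" for l
    unfolding sum_distrib_left[symmetric] sum_roots_of_unity[OF N] using N by simp
  ultimately have "((\<lambda>l. if int N dvd m l then fourier_coeff d f l else 0) has_sum lattice_coeff d N z f h) (int_vecs d)"
    by simp
  then show ?thesis
    by (subst has_sum_cong_neutral[where T = "int_vecs d" and g = "\<lambda>l. if int N dvd m l then fourier_coeff d f l else 0"])
      (auto simp: aliases_def in_dual_def m_def)
qed

lemma lattice_coeff_error:
  assumes N: "N > 0" and f: "continuous_periodic d f"
    and summ: "(\<lambda>h. cmod (fourier_coeff d f h)) summable_on int_vecs d" and h: "h \<in> int_vecs d"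
  shows "cmod (lattice_coeff d N z f h - fourier_coeff d f h) \<le>
         (\<Sum>\<^sub>\<infinity>l\<in>aliases d N z h - {h}. cmod (fourier_coeff d f l))"
proof -
  let ?B = "aliases d N z h - {h}"
  have h': "h \<in> aliases d N z h" using h by (simp add: aliases_def in_dual_def)
  have abs: "(\<lambda>l. cmod (fourier_coeff d f l)) summable_on ?B"
    by (rule summable_on_subset[OF summ]) (auto simp: aliases_def)
  then have "(fourier_coeff d f has_sum infsum (fourier_coeff d f) ?B) ?B"
    by (rule has_sum_infsum[OF abs_summable_summable])
  then have "(fourier_coeff d f has_sum fourier_coeff d f h + infsum (fourier_coeff d f) ?B) (insert h ?B)"
    by (intro has_sum_insert) auto
  moreover have "insert h ?B = aliases d N z h" using h' by blast
  ultimately have "lattice_coeff d N z f h = fourier_coeff d f h + infsum (fourier_coeff d f) ?B"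
    using lattice_coeff_has_sum[OF N f summ] has_sum_unique by metis
  then show ?thesis using norm_infsum_bound[OF abs] by simp
qed

definition reconstructs :: "nat \<Rightarrow> nat \<Rightarrow> (nat \<Rightarrow> int) set \<Rightarrow> (nat \<Rightarrow> nat) \<Rightarrow> (nat \<Rightarrow> int) \<Rightarrow> bool" where
  "reconstructs d N A z h \<longleftrightarrow> (\<forall>l\<in>A. l \<noteq> h \<longrightarrow> \<not> in_dual d N z (\<lambda>j. l j - h j))"

lemma in_dual_diff:
  assumes "in_dual d N z (\<lambda>j. l j - h j)" "in_dual d N z (\<lambda>j. l j - h' j)"
  shows "in_dual d N z (\<lambda>j. h' j - h j)"
proof -
  have "(\<Sum>j=1..d. (h' j - h j) * int (z j)) =
      (\<Sum>j=1..d. (l j - h j) * int (z j)) - (\<Sum>j=1..d. (l j - h' j) * int (z j))"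
    unfolding sum_subtractf[symmetric] by (intro sum.cong) (auto simp: algebra_simps)
  then show ?thesis using assms by (simp add: in_dual_def)
qed

text \<open>
  Frequencies reconstructed by the same \<open>z\<close> have disjoint alias classes, which meet \<open>A\<close> only
  in the frequency itself. Hence the total aliasing error is no larger than the truncation error.
\<close>

lemma sum_alias_errors_le:
  fixes a :: "(nat \<Rightarrow> int) \<Rightarrow> real"
  assumes A: "A \<subseteq> int_vecs d" and G: "finite G" "G \<subseteq> A" "\<And>h. h \<in> G \<Longrightarrow> reconstructs d N A z h"
    and nonneg: "\<And>l. a l \<ge> 0" and summ: "a summable_on int_vecs d"
  shows "(\<Sum>h\<in>G. \<Sum>\<^sub>\<infinity>l\<in>aliases d N z h - {h}. a l) \<le> (\<Sum>\<^sub>\<infinity>l\<in>int_vecs d - A. a l)"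
proof -
  have sub: "aliases d N z h - {h} \<subseteq> int_vecs d - A" if "h \<in> G" for h
    using G(3)[OF that] by (auto simp: aliases_def reconstructs_def)
  have "(\<Sum>h\<in>G. \<Sum>\<^sub>\<infinity>l\<in>aliases d N z h - {h}. a l) = infsum a (\<Union>h\<in>G. aliases d N z h - {h})"
  proof (rule sum_infsum[OF G(1)])
    show "a summable_on aliases d N z h - {h}" for h
      by (rule summable_on_subset[OF summ]) (auto simp: aliases_def)
    show "(aliases d N z h - {h}) \<inter> (aliases d N z h' - {h'}) = {}" if "h \<in> G" "h' \<in> G" "h \<noteq> h'" for h h'
    proof (rule ccontr)
      assume "(aliases d N z h - {h}) \<inter> (aliases d N z h' - {h'}) \<noteq> {}"
      then have "in_dual d N z (\<lambda>j. h' j - h j)" by (auto simp: aliases_def intro: in_dual_diff)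
      then show False using G(2) G(3)[OF that(1)] that by (auto simp: reconstructs_def)
    qed
  qed
  also have "\<dots> \<le> infsum a (int_vecs d - A)"
    by (rule infsum_mono2) (use sub nonneg in \<open>auto intro!: summable_on_subset[OF summ]\<close>)
  finally show ?thesis .
qed

lemma median_lattice_alg_error:
  assumes N: "N > 0" and f: "continuous_periodic d f"
    and summ: "(\<lambda>h. cmod (fourier_coeff d f h)) summable_on int_vecs d"
    and A: "finite A" "A \<subseteq> int_vecs d"
    and maj: "\<And>h. h \<in> A \<Longrightarrow> R div 2 < card {r\<in>{1..R}. reconstructs d N A (z r) h}"
    and x: "x \<in> cube d"
  shows "cmod (of_real (f x) - median_lattice_alg d N R z A f x) \<le>
         (2 * real R + 1) * (\<Sum>\<^sub>\<infinity>h\<in>int_vecs d - A. cmod (fourier_coeff d f h))"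
proof -
  define c where "c = fourier_coeff d f"
  define med where "med h = median_coeff d N R z f h" for h
  define B where "B = (\<Sum>\<^sub>\<infinity>h\<in>int_vecs d - A. cmod (c h))"
  define E where "E r h = (\<Sum>\<^sub>\<infinity>l\<in>aliases d N (z r) h - {h}. cmod (c l))" for r h
  define good where "good r = {h \<in> A. reconstructs d N A (z r) h}" for r
  have E_nonneg: "E r h \<ge> 0" for r h unfolding E_def by (rule infsum_nonneg) simp
  have summ_diff: "(\<lambda>h. cmod (c h * fchar d h x)) summable_on int_vecs d - A"
    using summable_on_subset[OF summ, of "int_vecs d - A"] by (simp add: c_def norm_mult)
  have "((\<lambda>h. c h * fchar d h x) has_sum (\<Sum>h\<in>A. c h * fchar d h x) + (\<Sum>\<^sub>\<infinity>h\<in>int_vecs d - A. c h * fchar d h x))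
      (A \<union> (int_vecs d - A))"
    by (rule has_sum_Un_disjoint[OF has_sum_finite[OF A(1)]
          has_sum_infsum[OF abs_summable_summable[OF summ_diff]]]) simp
  moreover have "A \<union> (int_vecs d - A) = int_vecs d" using A by blast
  ultimately have "((\<lambda>h. c h * fchar d h x) has_sum (\<Sum>h\<in>A. c h * fchar d h x) + (\<Sum>\<^sub>\<infinity>h\<in>int_vecs d - A. c h * fchar d h x))
      (int_vecs d)" by (simp only:)
  then have fx: "of_real (f x) = (\<Sum>h\<in>A. c h * fchar d h x) + (\<Sum>\<^sub>\<infinity>h\<in>int_vecs d - A. c h * fchar d h x)"
    by (rule has_sum_unique[OF fourier_inversion[OF f summ x, folded c_def]])
  have tail: "cmod (\<Sum>\<^sub>\<infinity>h\<in>int_vecs d - A. c h * fchar d h x) \<le> B"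
    using norm_infsum_bound[OF summ_diff] by (simp add: B_def norm_mult)
  \<comment> \<open>The common error bound for the good vectors at \<open>h\<close> will be the sum
    of their errors instead of the maximum. The sums over \<open>r\<close> and \<open>h\<close> can
    then be exchanged, and each vector contributes at most \<open>B\<close>.\<close>
  have alg: "median_lattice_alg d N R z A f x = (\<Sum>h\<in>A. med h * fchar d h x)"
    by (simp add: median_lattice_alg_def med_def fchar_def)
  have med: "cmod (med h - c h) \<le> 2 * (\<Sum>r\<in>{r\<in>{1..R}. reconstructs d N A (z r) h}. E r h)" if h: "h \<in> A" for h
    unfolding med_def median_coeff_def
  proof (rule cmod_cmedian_diff_le[OF _ maj[OF h]])
    fix r assume r: "r \<in> {r\<in>{1..R}. reconstructs d N A (z r) h}"
    have "cmod (lattice_coeff d N (z r) f h - c h) \<le> E r h"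
      unfolding c_def E_def by (rule lattice_coeff_error[OF N f summ]) (use h A in auto)
    also have "\<dots> \<le> (\<Sum>r\<in>{r\<in>{1..R}. reconstructs d N A (z r) h}. E r h)"
      by (rule member_le_sum) (use r E_nonneg in auto)
    finally show "cmod (lattice_coeff d N (z r) f h - c h) \<le> (\<Sum>r\<in>{r\<in>{1..R}. reconstructs d N A (z r) h}. E r h)" .
  qed auto
  have "(\<Sum>h\<in>A. cmod (med h - c h)) \<le> (\<Sum>h\<in>A. 2 * (\<Sum>r\<in>{r\<in>{1..R}. reconstructs d N A (z r) h}. E r h))"
    by (intro sum_mono med)
  also have "\<dots> = 2 * (\<Sum>r\<in>{1..R}. \<Sum>h\<in>good r. E r h)"
    unfolding sum_distrib_left[symmetric] good_def
    by (subst sum.swap_restrict) (use A in auto)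
  also have "\<dots> \<le> 2 * (\<Sum>r\<in>{1..R}. B)"
    unfolding E_def B_def
    by (intro mult_left_mono sum_mono sum_alias_errors_le) (use A summ in \<open>auto simp: good_def c_def\<close>)
  also have "\<dots> = 2 * real R * B" by simp
  finally have sum_med: "(\<Sum>h\<in>A. cmod (med h - c h)) \<le> 2 * real R * B" .
  have "of_real (f x) - median_lattice_alg d N R z A f x =
      (\<Sum>h\<in>A. (c h - med h) * fchar d h x) + (\<Sum>\<^sub>\<infinity>h\<in>int_vecs d - A. c h * fchar d h x)"
    unfolding fx alg by (simp add: left_diff_distrib sum_subtractf)
  also have "cmod \<dots> \<le> (\<Sum>h\<in>A. cmod (med h - c h)) + B"
  proof (rule norm_triangle_le[OF add_mono[OF _ tail]])
    have "cmod (\<Sum>h\<in>A. (c h - med h) * fchar d h x) \<le> (\<Sum>h\<in>A. cmod ((c h - med h) * fchar d h x))"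
      by (rule norm_sum)
    then show "cmod (\<Sum>h\<in>A. (c h - med h) * fchar d h x) \<le> (\<Sum>h\<in>A. cmod (med h - c h))"
      by (simp add: norm_mult norm_minus_commute)
  qed
  also have "\<dots> \<le> (2 * real R + 1) * B" using sum_med by (simp add: distrib_right)
  finally show ?thesis by (simp add: B_def c_def)
qed

section \<open>Truncation error in the Korobov space by the Cauchy-Schwarz inequality\<close>

lemma sum_norm_le_sqrt_weighted:
  fixes a r :: "'a \<Rightarrow> real"
  assumes "\<And>h. r h > 0" "(\<Sum>h\<in>F. (a h)\<^sup>2 * r h) \<le> 1" "\<And>h. a h \<ge> 0"
  shows "(\<Sum>h\<in>F. a h) \<le> sqrt (\<Sum>h\<in>F. 1 / r h)"
proof -
  have "(\<Sum>h\<in>F. a h) = (\<Sum>h\<in>F. \<bar>a h * sqrt (r h)\<bar> * \<bar>1 / sqrt (r h)\<bar>)"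
    using assms by (intro sum.cong) (auto simp: less_imp_le[OF assms(1)] abs_mult less_imp_neq[OF assms(1), symmetric])
  also have "\<dots> \<le> L2_set (\<lambda>h. a h * sqrt (r h)) F * L2_set (\<lambda>h. 1 / sqrt (r h)) F"
    by (rule L2_set_mult_ineq)
  also have "L2_set (\<lambda>h. 1 / sqrt (r h)) F = sqrt (\<Sum>h\<in>F. 1 / r h)"
    unfolding L2_set_def by (simp add: power_divide less_imp_le[OF assms(1)])
  also have "L2_set (\<lambda>h. a h * sqrt (r h)) F = sqrt (\<Sum>h\<in>F. (a h)\<^sup>2 * r h)"
    unfolding L2_set_def by (simp add: power_mult_distrib less_imp_le[OF assms(1)])
  also have "sqrt (\<Sum>h\<in>F. (a h)\<^sup>2 * r h) * sqrt (\<Sum>h\<in>F. 1 / r h) \<le> 1 * sqrt (\<Sum>h\<in>F. 1 / r h)"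
    using assms by (intro mult_right_mono) (auto intro!: sum_nonneg less_imp_le[OF assms(1)])
  finally show ?thesis by simp
qed

text \<open>A bound uniform in all finite subsets gives both summability and the bound on the sum.
  It is applied to all frequencies, where only summability matters, and to those outside the
  computed set, where \<open>W\<close> determines the rate.\<close>

lemma korobov_infsum_cmod_le:
  assumes f: "f \<in> korobov_space d \<alpha> \<gamma>" "korobov_norm d \<alpha> \<gamma> f \<le> 1"
    and pos: "\<And>h. freq_weight d \<alpha> \<gamma> h > 0" and V: "V \<subseteq> int_vecs d"
    and W: "\<And>F. finite F \<Longrightarrow> F \<subseteq> V \<Longrightarrow> (\<Sum>h\<in>F. 1 / freq_weight d \<alpha> \<gamma> h) \<le> W"
  shows "(\<lambda>h. cmod (fourier_coeff d f h)) summable_on V"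
    and "(\<Sum>\<^sub>\<infinity>h\<in>V. cmod (fourier_coeff d f h)) \<le> sqrt W"
proof -
  let ?a = "\<lambda>h. cmod (fourier_coeff d f h)"
  have fin: "(\<Sum>h\<in>F. ?a h) \<le> sqrt W" if F: "finite F" "F \<subseteq> V" for F
  proof -
    have "(\<Sum>h\<in>F. (?a h)\<^sup>2 * freq_weight d \<alpha> \<gamma> h) \<le> (\<Sum>\<^sub>\<infinity>h\<in>int_vecs d. (?a h)\<^sup>2 * freq_weight d \<alpha> \<gamma> h)"
      by (rule finite_sum_le_infsum) (use f F V in \<open>auto simp: korobov_space_def less_imp_le[OF pos]\<close>)
    also have "\<dots> \<le> 1" using f(2) by (simp add: korobov_norm_def)
    finally have "(\<Sum>h\<in>F. ?a h) \<le> sqrt (\<Sum>h\<in>F. 1 / freq_weight d \<alpha> \<gamma> h)"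
      by (intro sum_norm_le_sqrt_weighted pos) auto
    also have "\<dots> \<le> sqrt W" using W[OF F] by simp
    finally show ?thesis .
  qed
  show summ: "?a summable_on V"
    by (rule nonneg_bdd_above_summable_on) (use fin in \<open>auto intro!: bdd_aboveI\<close>)
  show "infsum ?a V \<le> sqrt W" by (rule infsum_le_finite_sums[OF summ fin])
qed

subsection \<open>Error bound\<close>

text \<open>In terms of \<open>rho\<close> the exponent becomes \<open>2 * \<alpha> * q\<close>,
  which exceeds 1 by the lower bound on \<open>q\<close>; so the zeta series converges.\<close>

lemma sum_inverse_freq_weight_le:
  assumes \<alpha>: "\<alpha> > 1 / 2" and \<gamma>: "\<And>j. 1 \<le> j \<Longrightarrow> 0 < \<gamma> j \<and> \<gamma> j \<le> 1"
    and q: "1 / (2 * \<alpha>) < q" "q < 1" and F: "finite F" "F \<subseteq> int_vecs d"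
  shows "(\<Sum>h\<in>F. freq_weight d \<alpha> \<gamma> h powr (- q)) \<le> (\<Prod>j=1..d. 1 + 2 * \<gamma> j powr q * zeta (2 * \<alpha> * q))"
proof -
  have q1: "2 * \<alpha> * q > 1" using q(1) \<alpha> by (simp add: field_simps)
  have "(\<Sum>h\<in>F. rho {1..d} (\<lambda>j. \<gamma> j powr (1 / (2 * \<alpha>))) h powr (- (2 * \<alpha> * q))) \<le>
      (\<Prod>j=1..d. 1 + 2 * (\<gamma> j powr (1 / (2 * \<alpha>))) powr (2 * \<alpha> * q) * zeta (2 * \<alpha> * q))"
  proof (rule sum_rho_powr_le)
    show "0 < \<gamma> i powr (1 / (2 * \<alpha>))" if "i \<in> {1..d}" for i using \<gamma>[of i] that by simp
  qed (use F q1 in \<open>auto simp: int_vecs_def\<close>)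
  then show ?thesis using \<alpha> \<gamma> by (simp add: freq_weight_eq_rho powr_powr mult_ac)
qed

lemma freq_weight_ge_1:
  assumes "\<alpha> > 1 / 2" and \<gamma>: "\<And>j. 1 \<le> j \<Longrightarrow> 0 < \<gamma> j \<and> \<gamma> j \<le> 1"
  shows "freq_weight d \<alpha> \<gamma> h \<ge> 1"
proof -
  have "rho {1..d} (\<lambda>j. \<gamma> j powr (1 / (2 * \<alpha>))) h \<ge> 1"
  proof (rule rho_ge_1)
    show "0 < \<gamma> i powr (1 / (2 * \<alpha>)) \<and> \<gamma> i powr (1 / (2 * \<alpha>)) \<le> 1" if "i \<in> {1..d}" for i
      using \<gamma>[of i] that assms(1) by (auto intro!: powr_le1)
  qed
  then show ?thesis using assms by (simp add: freq_weight_eq_rho ge_one_powr_ge_zero)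
qed

text \<open>
  Outside \<open>freq_set d \<alpha> \<gamma> L\<close> a factor \<open>L powr (- 2\<alpha>(1 - q))\<close> can be split off. As the zero frequency
  lies inside, what remains is at most \<open>P - 1\<close>, where \<open>P\<close> is the product over the coordinates.
\<close>

lemma sum_inverse_freq_weight_tail_le:
  assumes \<alpha>: "\<alpha> > 1 / 2" and \<gamma>: "\<And>j. 1 \<le> j \<Longrightarrow> 0 < \<gamma> j \<and> \<gamma> j \<le> 1"
    and q: "1 / (2 * \<alpha>) < q" "q < 1" and L: "L > 1" and F: "finite F" "F \<subseteq> int_vecs d - freq_set d \<alpha> \<gamma> L"
  shows "(\<Sum>h\<in>F. 1 / freq_weight d \<alpha> \<gamma> h) \<le>
    1 / (\<gamma> 1 powr (1 / (4 * \<alpha>)) * L) powr (1 / q - 1) * (q / (1 - q)) *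
    (\<Prod>j=1..d. (1 + 2 * \<gamma> j powr q * zeta (2 * \<alpha> * q)) powr (1 / q))"
proof -
  define s where "s = 1 / q - 1"
  define P where "P = (\<Prod>j=1..d. 1 + 2 * \<gamma> j powr q * zeta (2 * \<alpha> * q))"
  define z :: "nat \<Rightarrow> int" where "z = (\<lambda>j\<in>{1..d}. 0)"
  have q0: "q > 0" using q(1) \<alpha> by (meson less_trans zero_less_divide_1_iff zero_less_mult_iff half_gt_zero zero_less_numeral)
  have q1: "2 * \<alpha> * q > 1" using q(1) \<alpha> by (simp add: field_simps)
  have s: "s > 0" using q0 q(2) by (simp add: s_def)
  have P1: "P \<ge> 1" unfolding P_def
    by (rule prod_ge_1) (use zeta_nonneg[OF q1] in auto)
  have "supp d z = {}" by (auto simp: supp_def z_def)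
  then have fw_z: "freq_weight d \<alpha> \<gamma> z = 1" by (simp add: freq_weight_def weight_def)
  have z: "z \<in> int_vecs d" by (simp add: z_def int_vecs_def)
  have zF: "z \<notin> F" using F(2) z fw_z L \<alpha> by (auto simp: freq_set_def)
  \<comment> \<open>The natural decay exponent \<open>2 * \<alpha> * (1 - q)\<close> is weakened to
    \<open>1 / q - 1\<close>, the exponent of the final bound.\<close>
  have s_le: "s \<le> 2 * \<alpha> * (1 - q)"
  proof -
    have "1 * (1 - q) \<le> (2 * \<alpha> * q) * (1 - q)" using q1 q(2) by (intro mult_right_mono) auto
    then show ?thesis using q0 by (simp add: s_def field_simps)
  qed
  have "(\<Sum>h\<in>F. 1 / freq_weight d \<alpha> \<gamma> h) \<le> (\<Sum>h\<in>F. freq_weight d \<alpha> \<gamma> h powr (- q) * L powr (- s))"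
  proof (rule sum_mono)
    fix h assume h: "h \<in> F"
    let ?r = "freq_weight d \<alpha> \<gamma> h"
    have r: "?r \<ge> 1" by (rule freq_weight_ge_1) (use \<alpha> \<gamma> in auto)
    have "?r \<ge> L powr (2 * \<alpha>)" using h F(2) by (auto simp: freq_set_def)
    then have "?r powr (- (1 - q)) \<le> (L powr (2 * \<alpha>)) powr (- (1 - q))"
      using L q(2) by (intro powr_mono2') auto
    also have "\<dots> = L powr (- (2 * \<alpha> * (1 - q)))" by (simp add: powr_powr algebra_simps)
    also have "\<dots> \<le> L powr (- s)" using s_le L by (intro powr_mono) auto
    finally have "?r powr (- q) * ?r powr (- (1 - q)) \<le> ?r powr (- q) * L powr (- s)"
      by (rule mult_left_mono) simp
    moreover have "?r powr (- q) * ?r powr (- (1 - q)) = ?r powr (- 1)"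
      unfolding powr_add[symmetric] by simp
    then have "?r powr (- q) * ?r powr (- (1 - q)) = 1 / ?r"
      using r by (simp add: powr_minus_divide)
    ultimately show "1 / ?r \<le> ?r powr (- q) * L powr (- s)" by simp
  qed
  also have "\<dots> = (\<Sum>h\<in>F. freq_weight d \<alpha> \<gamma> h powr (- q)) * L powr (- s)"
    by (simp add: sum_distrib_right)
  also have "\<dots> \<le> (P - 1) * L powr (- s)"
  proof (rule mult_right_mono)
    have "(\<Sum>h\<in>insert z F. freq_weight d \<alpha> \<gamma> h powr (- q)) \<le> P"
      unfolding P_def by (rule sum_inverse_freq_weight_le) (use \<alpha> \<gamma> q F z in auto)
    then show "(\<Sum>h\<in>F. freq_weight d \<alpha> \<gamma> h powr (- q)) \<le> P - 1" using F(1) zF fw_z by simp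
  qed simp
  also have "\<dots> \<le> (1 / s * P powr (1 + s)) * (\<gamma> 1 powr (1 / (4 * \<alpha>)) * L) powr (- s)"
  proof (rule mult_mono)
    show "P - 1 \<le> 1 / s * P powr (1 + s)" using Bernoulli_product_bound[OF P1 s] s by (simp add: field_simps)
    \<comment> \<open>Since this factor is at most 1 and the exponent is negative, inserting it next
      to \<open>L\<close> only enlarges the bound.\<close>
    have "\<gamma> 1 powr (1 / (4 * \<alpha>)) \<le> 1" using \<gamma>[of 1] \<alpha> by (intro powr_le1) auto
    then have "\<gamma> 1 powr (1 / (4 * \<alpha>)) * L \<le> L" using L by (simp add: mult_le_cancel_right1)
    moreover have "\<gamma> 1 powr (1 / (4 * \<alpha>)) * L > 0" using \<gamma>[of 1] L by simp
    ultimately show "L powr (- s) \<le> (\<gamma> 1 powr (1 / (4 * \<alpha>)) * L) powr (- s)"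
      using s by (intro powr_mono2') auto
  qed (use s in auto)
  also have "\<dots> = 1 / (\<gamma> 1 powr (1 / (4 * \<alpha>)) * L) powr s * (1 / s) * P powr (1 + s)"
    by (simp add: powr_minus_divide)
  also have "1 / s = q / (1 - q)" using q0 q(2) by (simp add: s_def field_simps)
  also have "P powr (1 + s) = (\<Prod>j=1..d. (1 + 2 * \<gamma> j powr q * zeta (2 * \<alpha> * q)) powr (1 / q))"
    unfolding P_def prod_powr_distrib by (simp add: s_def)
  finally show ?thesis by (simp only: s_def)
qed

section \<open>Probability that a majority of the vectors reconstructs every frequency\<close>

lemma prob_not_reconstructs_le:
  assumes N: "prime N" and A: "finite A" "A \<subseteq> int_vecs d" "h \<in> A"
    and small: "\<And>l j. l \<in> A \<Longrightarrow> j \<in> {1..d} \<Longrightarrow> 2 * \<bar>l j\<bar> < int N"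
  shows "measure_pmf.prob (pmf_of_set ({1..d} \<rightarrow>\<^sub>E {1..<N})) {z. \<not> reconstructs d N A z h} \<le>
         (real (card A) - 1) / (real N - 1)"
proof -
  let ?M = "measure_pmf (pmf_of_set ({1..d} \<rightarrow>\<^sub>E {1..<N}))"
  have "{z. \<not> reconstructs d N A z h} = (\<Union>l\<in>A - {h}. {z. in_dual d N z (\<lambda>j. l j - h j)})"
    by (auto simp: reconstructs_def)
  also have "measure ?M \<dots> \<le> (\<Sum>l\<in>A - {h}. measure ?M {z. in_dual d N z (\<lambda>j. l j - h j)})"
    by (rule measure_UNION_le) (use A in auto)
  also have "\<dots> \<le> (\<Sum>l\<in>A - {h}. 1 / (real N - 1))"
  proof (rule sum_mono)
    fix l assume l: "l \<in> A - {h}"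
    then have "l \<in> {1..d} \<rightarrow>\<^sub>E UNIV" "h \<in> {1..d} \<rightarrow>\<^sub>E UNIV" "l \<noteq> h" using A by (auto simp: int_vecs_def)
    then obtain j where j: "j \<in> {1..d}" "l j \<noteq> h j" by (metis PiE_ext)
    \<comment> \<open>Both entries are below \<open>N / 2\<close> in absolute value, so distinct
      entries are incongruent modulo \<open>N\<close>.\<close>
    have "\<bar>l j - h j\<bar> < int N" using small[of l j] small[of h j] l A(3) j(1) by auto
    then have "\<not> int N dvd l j - h j"
      using j(2) zdvd_not_zless[of "\<bar>l j - h j\<bar>" "int N"] by auto
    then show "measure ?M {z. in_dual d N z (\<lambda>j. l j - h j)} \<le> 1 / (real N - 1)"
      by (rule prob_in_dual_le[OF N j(1)])
  qed
  also have "\<dots> = (real (card A) - 1) / (real N - 1)"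
  proof -
    have "card A > 0" using A card_gt_0_iff by blast
    then show ?thesis using A by (simp add: of_nat_diff)
  qed
  finally show ?thesis .
qed

text \<open>For \<open>R = 2 * m + 1\<close>, a missing majority means at least \<open>m + 1\<close>
  failures. Bounding the binomial coefficient by \<open>2 ^ R\<close> gives
  \<open>2 ^ R * t ^ (m + 1) = (4 * t) ^ (m + 1) / 2\<close>, the origin of the constants 4 and
  1/2.\<close>

lemma prob_majority_reconstructs_ge:
  assumes A: "finite A" and t: "t \<ge> 0"
    and p: "\<And>h. h \<in> A \<Longrightarrow> measure_pmf.prob (pmf_of_set ({1..d} \<rightarrow>\<^sub>E {1..<N})) {z. \<not> reconstructs d N A z h} \<le> t"
    and R: "odd R"
  shows "measure_pmf.prob (gen_vectors d N R) {z. \<forall>h\<in>A. R div 2 < card {r\<in>{1..R}. reconstructs d N A (z r) h}} \<ge>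
         1 - real (card A) / 2 * (4 * t) ^ Suc (R div 2)"
proof -
  define m where "m = R div 2"
  have Rm: "R = 2 * m + 1" using R by (auto simp: m_def elim: oddE)
  let ?M = "measure_pmf (gen_vectors d N R)"
  define good where "good = {z. \<forall>h\<in>A. R div 2 < card {r\<in>{1..R}. reconstructs d N A (z r) h}}"
  define bad where "bad h = {z. Suc m \<le> card {r\<in>{1..R}. z r \<in> {z. \<not> reconstructs d N A z h}}}" for h
  have "- good \<subseteq> (\<Union>h\<in>A. bad h)"
  proof
    fix z assume "z \<in> - good"
    then obtain h where h: "h \<in> A" "card {r\<in>{1..R}. reconstructs d N A (z r) h} \<le> m"
      by (auto simp: good_def m_def not_less)
    have "card {r\<in>{1..R}. reconstructs d N A (z r) h} + card {r\<in>{1..R}. \<not> reconstructs d N A (z r) h} = card {1..R}"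
    proof -
      have "{1..R} = {r\<in>{1..R}. reconstructs d N A (z r) h} \<union> {r\<in>{1..R}. \<not> reconstructs d N A (z r) h}"
        by blast
      moreover have "card \<dots> = card {r\<in>{1..R}. reconstructs d N A (z r) h} + card {r\<in>{1..R}. \<not> reconstructs d N A (z r) h}"
        by (rule card_Un_disjoint) auto
      ultimately show ?thesis by (simp only:)
    qed
    then have "z \<in> bad h" using h(2) Rm by (simp add: bad_def)
    then show "z \<in> (\<Union>h\<in>A. bad h)" using h(1) by blast
  qed
  then have "measure ?M (- good) \<le> measure ?M (\<Union>h\<in>A. bad h)"
    by (intro measure_pmf.finite_measure_mono) auto
  also have "\<dots> \<le> (\<Sum>h\<in>A. measure ?M (bad h))"
    by (rule measure_UNION_le) (use A in auto)
  also have "\<dots> \<le> (\<Sum>h\<in>A. (4 * t) ^ Suc m / 2)"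
  proof (rule sum_mono)
    fix h assume h: "h \<in> A"
    have "measure ?M (bad h) \<le> real (R choose Suc m) * t ^ Suc m"
      unfolding bad_def gen_vectors_def by (rule prob_many_of_iid_le[OF p[OF h]])
    also have "\<dots> \<le> 2 ^ R * t ^ Suc m"
    proof (rule mult_right_mono)
      have "R choose Suc m \<le> 2 ^ R"
        unfolding choose_row_sum[symmetric] by (rule member_le_sum) (auto simp: Rm)
      then have "real (R choose Suc m) \<le> real (2 ^ R)" by (rule of_nat_mono)
      then show "real (R choose Suc m) \<le> 2 ^ R" by simp
    qed (use t in simp)
    also have "(2::real) ^ R * t ^ Suc m = (4 * t) ^ Suc m / 2"
      by (simp add: Rm power_mult power_mult_distrib)
    finally show "measure ?M (bad h) \<le> (4 * t) ^ Suc m / 2" .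
  qed
  also have "\<dots> = real (card A) / 2 * (4 * t) ^ Suc (R div 2)" by (simp add: m_def)
  finally show ?thesis using measure_pmf.prob_compl[of good "gen_vectors d N R"]
    by (simp add: good_def Compl_eq_Diff_UNIV)
qed

text \<open>
  With \<open>T = 1 + \<tau> ln N2\<close>, the definition of \<open>N2\<close> turns \<open>card_rho_ball_le\<close> into
  \<open>(card A - 1) T \<le> N - 1\<close>.
\<close>

lemma freq_set_threshold_bounds:
  fixes \<alpha> \<tau> :: real and d N :: nat and \<gamma> :: "nat \<Rightarrow> real"
  defines "N2 \<equiv> threshold_N2 N d \<tau> \<alpha> \<gamma>"
  assumes \<alpha>: "\<alpha> > 1 / 2" and \<tau>: "\<tau> > 0" and \<gamma>: "\<And>j. 1 \<le> j \<Longrightarrow> 0 < \<gamma> j \<and> \<gamma> j \<le> 1"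
    and N: "N > 1" and N2: "N2 > 1"
  shows "finite (freq_set d \<alpha> \<gamma> N2)"
    and "(1 + \<tau> * ln N2) * (real (card (freq_set d \<alpha> \<gamma> N2)) - 1) \<le> real N - 1"
    and "\<And>l j. l \<in> freq_set d \<alpha> \<gamma> N2 \<Longrightarrow> j \<in> {1..d} \<Longrightarrow> 2 * \<bar>l j\<bar> < int N"
proof -
  define g where "g j = \<gamma> j powr (1 / (2 * \<alpha>))" for j
  define P where "P = (\<Prod>j=1..d. 1 + 2 * g j * (1 + \<tau> * ln (real N)))"
  define T where "T = 1 + \<tau> * ln N2"
  have g: "0 < g j \<and> g j \<le> 1" if "j \<in> {1..d}" for j
    using \<gamma>[of j] that \<alpha> by (auto simp: g_def intro!: powr_le1)
  have A: "freq_set d \<alpha> \<gamma> N2 = rho_ball {1..d} g N2"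
    unfolding g_def by (rule freq_set_eq_rho_ball) (use \<alpha> \<gamma> N2 in auto)
  have P_eq: "threshold_P N d \<tau> \<alpha> \<gamma> = P" by (simp add: threshold_P_def P_def g_def)
  have lnN: "ln (real N) \<ge> 0" using N by simp
  have factor: "1 \<le> 1 + 2 * g j * (1 + \<tau> * ln (real N))" if "j \<in> {1..d}" for j
    using g[OF that] \<tau> lnN by simp
  then have P1: "P \<ge> 1" unfolding P_def by (intro prod_ge_1) auto
  have exp1: "exp (1 / \<tau>) \<ge> 1" using \<tau> by simp
  have D: "exp (1 / \<tau>) * P \<ge> 1" using mult_mono[OF exp1 P1] by simp
  have N_eq: "real N - 1 = N2 * exp (1 / \<tau>) * P"
  proof -
    have "exp (1 / \<tau>) * P \<noteq> 0" using D by linarith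
    moreover have "N2 = (real N - 1) / (exp (1 / \<tau>) * P)" by (simp add: N2_def threshold_N2_def P_eq)
    ultimately have "N2 * (exp (1 / \<tau>) * P) = real N - 1" by (rule nonzero_eq_divide_eq[THEN iffD1])
    then show ?thesis by (simp only: mult.assoc)
  qed
  have N2_le: "N2 \<le> real N"
  proof -
    have "N2 * 1 \<le> N2 * (exp (1 / \<tau>) * P)" using D N2 by (intro mult_left_mono) auto
    then show ?thesis using N_eq by (simp add: mult.assoc)
  qed
  show fin: "finite (freq_set d \<alpha> \<gamma> N2)"
    unfolding A by (rule finite_rho_ball) (use g in auto)
  \<comment> \<open>As \<open>N2 \<le> N\<close>, the logarithm of \<open>N2\<close> from the
    counting bound may be replaced by that of \<open>N\<close>, which occurs in
    \<open>threshold_P\<close>.\<close>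
  have T: "T \<le> 1 + \<tau> * ln (real N)" "T \<ge> 0"
    unfolding T_def using N2 N2_le \<tau> by (auto intro!: mult_left_mono)
  have "(1 + \<tau> * ln N2) * (real (card (freq_set d \<alpha> \<gamma> N2)) - 1) \<le>
      N2 * exp (1 / \<tau>) * ((\<Prod>j=1..d. 1 + 2 * g j * T) - 1)"
    unfolding A T_def by (rule card_rho_ball_le) (use g N2 \<tau> in auto)
  also have "\<dots> \<le> N2 * exp (1 / \<tau>) * P"
  proof (rule mult_left_mono)
    have "(\<Prod>j=1..d. 1 + 2 * g j * T) \<le> P"
      unfolding P_def
    proof (intro prod_mono conjI add_left_mono mult_left_mono T)
      fix i assume "i \<in> {1..d}"
      then have "g i > 0" using g by blast
      then show "0 \<le> 1 + 2 * g i * T" "0 \<le> 2 * g i" using T by simp_all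
    qed
    then show "(\<Prod>j=1..d. 1 + 2 * g j * T) - 1 \<le> P" by simp
  qed (use N2 in simp)
  finally show "(1 + \<tau> * ln N2) * (real (card (freq_set d \<alpha> \<gamma> N2)) - 1) \<le> real N - 1"
    unfolding N_eq .
  fix l j assume l: "l \<in> freq_set d \<alpha> \<gamma> N2" and j: "j \<in> {1..d}"
  have "\<bar>real_of_int (l j)\<bar> \<le> g j * rho {1..d} g l"
    by (rule rho_coordinate_le) (use g j in auto)
  also have "\<dots> \<le> g j * N2" using l g[OF j] by (intro mult_left_mono) (auto simp: A rho_ball_def)
  finally have lj: "2 * \<bar>real_of_int (l j)\<bar> \<le> N2 * (2 * g j)" by (simp add: mult.commute)
  \<comment> \<open>Already the factor of coordinate \<open>j\<close> dominates
    \<open>2 * g j\<close>, and all other factors of \<open>P\<close> are at least 1. Hence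
    \<open>2 * \<bar>l j\<bar>\<close> is at most
    \<open>N2 * exp (1 / \<tau>) * P = N - 1\<close>.\<close>
  have "2 * g j \<le> 1 + 2 * g j * (1 + \<tau> * ln (real N))"
    using g[OF j] \<tau> lnN by (simp add: distrib_left)
  also have "\<dots> \<le> P"
  proof -
    have "1 \<le> (\<Prod>i\<in>{1..d} - {j}. 1 + 2 * g i * (1 + \<tau> * ln (real N)))"
      using factor by (intro prod_ge_1) auto
    then have "(1 + 2 * g j * (1 + \<tau> * ln (real N))) * 1 \<le>
        (1 + 2 * g j * (1 + \<tau> * ln (real N))) * (\<Prod>i\<in>{1..d} - {j}. 1 + 2 * g i * (1 + \<tau> * ln (real N)))"
      using factor[OF j] by (intro mult_left_mono) auto
    then show ?thesis unfolding P_def using j by (subst prod.remove[of _ j]) auto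
  qed
  also have "P \<le> exp (1 / \<tau>) * P" using mult_right_mono[OF exp1, of P] P1 by simp
  finally have "N2 * (2 * g j) \<le> N2 * (exp (1 / \<tau>) * P)" using N2 by (intro mult_left_mono) auto
  with lj have "2 * \<bar>real_of_int (l j)\<bar> < real N" using N_eq by (simp add: mult.assoc)
  then have "real_of_int (2 * \<bar>l j\<bar>) < real_of_int (int N)" by simp
  then show "2 * \<bar>l j\<bar> < int N" by (simp only: of_int_less_iff)
qed

theorem theorem4p6:
  fixes \<alpha> \<tau> q :: real and d R N :: nat and \<gamma> :: "nat \<Rightarrow> real"
  defines "N2 \<equiv> threshold_N2 N d \<tau> \<alpha> \<gamma>"
  assumes "\<alpha> > 1 / 2" and "d \<ge> 1" and "\<tau> > 0" and "R > 1" and "odd R"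
    and "\<And>i j. 1 \<le> i \<Longrightarrow> i \<le> j \<Longrightarrow> \<gamma> j \<le> \<gamma> i"
    and "\<And>j. 1 \<le> j \<Longrightarrow> 0 < \<gamma> j \<and> \<gamma> j \<le> 1"
    and "prime N" and "odd N"
    and "N2 > 1"
    and "failure_prob d \<alpha> \<gamma> \<tau> N R \<le> 1"
    and "1 / (2 * \<alpha>) < q" and "q < 1"
  shows "measure_pmf.prob (gen_vectors d N R)
           {z. err_Linf d \<alpha> \<gamma> (median_lattice_alg d N R z (freq_set d \<alpha> \<gamma> N2))
               \<le> ereal ((2 * real R + 1) *
                   sqrt (1 / (\<gamma> 1 powr (1 / (4 * \<alpha>)) * N2) powr (1 / q - 1) * (q / (1 - q)) *
                         (\<Prod>j=1..d. (1 + 2 * \<gamma> j powr q * zeta (2 * \<alpha> * q)) powr (1 / q))))}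
         \<ge> 1 - failure_prob d \<alpha> \<gamma> \<tau> N R"
proof -
  note \<alpha> = \<open>\<alpha> > 1 / 2\<close> and \<tau> = \<open>\<tau> > 0\<close> and N2 = \<open>N2 > 1\<close>
  note \<gamma> = \<open>\<And>j. 1 \<le> j \<Longrightarrow> 0 < \<gamma> j \<and> \<gamma> j \<le> 1\<close>
  define A where "A = freq_set d \<alpha> \<gamma> N2"
  define T where "T = 1 + \<tau> * ln N2"
  define W where "W = 1 / (\<gamma> 1 powr (1 / (4 * \<alpha>)) * N2) powr (1 / q - 1) * (q / (1 - q)) *
     (\<Prod>j=1..d. (1 + 2 * \<gamma> j powr q * zeta (2 * \<alpha> * q)) powr (1 / q))"
  define good where "good = {z. \<forall>h\<in>A. R div 2 < card {r\<in>{1..R}. reconstructs d N A (z r) h}}"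
  have N1: "N > 1" using \<open>prime N\<close> by (rule prime_gt_1_nat)
  note bounds = freq_set_threshold_bounds[OF \<alpha> \<tau> \<gamma> N1 N2[unfolded N2_def],
      folded N2_def, folded A_def T_def]
  have finA: "finite A" and cardA: "T * (real (card A) - 1) \<le> real N - 1"
    and smallA: "\<And>l j. l \<in> A \<Longrightarrow> j \<in> {1..d} \<Longrightarrow> 2 * \<bar>l j\<bar> < int N"
    using bounds by auto
  have A_sub: "A \<subseteq> int_vecs d" by (auto simp: A_def freq_set_def)
  have T: "T > 0" unfolding T_def using N2 \<tau> by (intro add_pos_nonneg) auto
  have fw: "freq_weight d \<alpha> \<gamma> h \<ge> 1" for h by (rule freq_weight_ge_1) (use \<alpha> \<gamma> in auto)
  have fw_pos: "freq_weight d \<alpha> \<gamma> h > 0" for h using fw[of h] by linarith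
  \<comment> \<open>The deterministic part. Membership in \<open>good\<close> does not involve
    \<open>f\<close>, so one event serves the whole unit ball.\<close>
  have err: "err_Linf d \<alpha> \<gamma> (median_lattice_alg d N R z A) \<le> ereal ((2 * real R + 1) * sqrt W)"
    if z: "z \<in> good" for z
    unfolding err_Linf_def
  proof (rule SUP_least)
    fix f assume "f \<in> {f \<in> korobov_space d \<alpha> \<gamma>. korobov_norm d \<alpha> \<gamma> f \<le> 1}"
    then have f: "f \<in> korobov_space d \<alpha> \<gamma>" "korobov_norm d \<alpha> \<gamma> f \<le> 1" by auto
    then have per: "continuous_periodic d f" and meas: "f \<in> borel_measurable (unit_cube d)"
      by (auto simp: korobov_space_def)
    \<comment> \<open>Weights are at least 1 and \<open>q < 1\<close>, so the inverse weight is at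
      most its \<open>q\<close>-th power. This crude bound yields the summability needed for
      inversion and aliasing.\<close>
    have total: "(\<Sum>h\<in>F. 1 / freq_weight d \<alpha> \<gamma> h) \<le> (\<Prod>j=1..d. 1 + 2 * \<gamma> j powr q * zeta (2 * \<alpha> * q))"
      if F: "finite F" "F \<subseteq> int_vecs d" for F
    proof -
      have "(\<Sum>h\<in>F. 1 / freq_weight d \<alpha> \<gamma> h) \<le> (\<Sum>h\<in>F. freq_weight d \<alpha> \<gamma> h powr (- q))"
      proof (rule sum_mono)
        fix h
        show "1 / freq_weight d \<alpha> \<gamma> h \<le> freq_weight d \<alpha> \<gamma> h powr (- q)"
          using powr_mono[of "- 1" "- q" "freq_weight d \<alpha> \<gamma> h"] fw[of h] \<open>q < 1\<close> by (simp add: powr_minus_divide)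
      qed
      also have "\<dots> \<le> (\<Prod>j=1..d. 1 + 2 * \<gamma> j powr q * zeta (2 * \<alpha> * q))"
        by (rule sum_inverse_freq_weight_le) (use \<alpha> \<gamma> assms(13,14) F in auto)
      finally show ?thesis .
    qed
    have summ: "(\<lambda>h. cmod (fourier_coeff d f h)) summable_on int_vecs d"
      by (rule korobov_infsum_cmod_le(1)[OF f fw_pos order_refl total])
    have tail: "(\<Sum>\<^sub>\<infinity>h\<in>int_vecs d - A. cmod (fourier_coeff d f h)) \<le> sqrt W"
      unfolding W_def A_def
      by (rule korobov_infsum_cmod_le(2)[OF f fw_pos Diff_subset
            sum_inverse_freq_weight_tail_le[OF \<alpha> \<gamma> assms(13,14) N2]])
    have bound: "cmod (of_real (f x) - median_lattice_alg d N R z A f x) \<le> (2 * real R + 1) * sqrt W"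
      if x: "x \<in> cube d" for x
    proof -
      have "cmod (of_real (f x) - median_lattice_alg d N R z A f x) \<le>
         (2 * real R + 1) * (\<Sum>\<^sub>\<infinity>h\<in>int_vecs d - A. cmod (fourier_coeff d f h))"
        by (rule median_lattice_alg_error) (use N1 per summ finA A_sub z x in \<open>auto simp: good_def\<close>)
      also have "\<dots> \<le> (2 * real R + 1) * sqrt W" by (intro mult_left_mono tail) auto
      finally show ?thesis .
    qed
    \<comment> \<open>Measurability matters because \<open>esssup\<close> of a non-measurable
      function is \<open>top\<close> by definition.\<close>
    have "median_lattice_alg d N R z A f \<in> borel_measurable (unit_cube d)"
      unfolding median_lattice_alg_def fchar_def[symmetric]
      by (intro borel_measurable_continuous_on_cube continuous_intros continuous_on_fchar)
    then have "(\<lambda>x. ereal (cmod (of_real (f x) - median_lattice_alg d N R z A f x))) \<in> borel_measurable (unit_cube d)"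
      using meas by measurable
    then show "Linf_norm d (\<lambda>x. of_real (f x) - median_lattice_alg d N R z A f x) \<le> ereal ((2 * real R + 1) * sqrt W)"
      unfolding Linf_norm_def by (rule esssup_I) (use bound in \<open>auto intro!: AE_I2\<close>)
  qed
  have p: "measure_pmf.prob (pmf_of_set ({1..d} \<rightarrow>\<^sub>E {1..<N})) {z. \<not> reconstructs d N A z h} \<le> 1 / T"
    if h: "h \<in> A" for h
  proof -
    have "measure_pmf.prob (pmf_of_set ({1..d} \<rightarrow>\<^sub>E {1..<N})) {z. \<not> reconstructs d N A z h} \<le>
       (real (card A) - 1) / (real N - 1)"
      by (rule prob_not_reconstructs_le[OF \<open>prime N\<close> finA A_sub h]) (rule smallA)
    also have "\<dots> \<le> 1 / T" using cardA T N1 by (simp add: field_simps)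
    finally show ?thesis .
  qed
  \<comment> \<open>For odd \<open>R\<close> the rounded-up half is the size of the smallest strict
    majority.\<close>
  have "nat \<lceil>real R / 2\<rceil> = Suc (R div 2)"
  proof -
    obtain m where "R = 2 * m + 1" using \<open>odd R\<close> by (auto elim: oddE)
    moreover have "\<lceil>real (2 * m + 1) / 2\<rceil> = int m + 1" by (rule ceiling_unique) auto
    ultimately show ?thesis by (simp add: nat_add_distrib)
  qed
  then have "1 - failure_prob d \<alpha> \<gamma> \<tau> N R = 1 - real (card A) / 2 * (4 * (1 / T)) ^ Suc (R div 2)"
    by (simp add: failure_prob_def A_def T_def N2_def)
  also have "\<dots> \<le> measure_pmf.prob (gen_vectors d N R) good"
    unfolding good_def by (rule prob_majority_reconstructs_ge[OF finA _ p \<open>odd R\<close>]) (use T in simp)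
  also have "\<dots> \<le> measure_pmf.prob (gen_vectors d N R)
      {z. err_Linf d \<alpha> \<gamma> (median_lattice_alg d N R z A) \<le> ereal ((2 * real R + 1) * sqrt W)}"
    by (rule measure_pmf.finite_measure_mono) (use err in auto)
  finally show ?thesis unfolding A_def W_def .
qed

end
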